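(* Let $N\ge 3$ be an integer and let $\mathbb{Q}_N^+=\mathbb{Q}(\zeta+\zeta^{-1})$, with $\zeta=e^{2\pi i/N}$, be the maximal real subfield of the cyclotomic field $\mathbb{Q}(\zeta)$. Then the set of primitive scales $$\left\{\mathrm{scale}[k]=\frac{\tan(\pi/N)}{\tan(k\pi/N)} : 1\le k<N/2,\ \gcd(k,N)=1\right\}$$ is a basis of $\mathbb{Q}_N^+$ as a vector space over $\mathbb{Q}$, and each of its elements is a unit of the ring of algebraic integers of $\mathbb{Q}_N^+$.
   Context: For a regular $N$-gon put $s_k=\tan(k\pi/N)$ for $1\le k<N/2$. The canonical scales are $\mathrm{scale}[k]=s_1/s_k$, $1\le k<N/2$; the primitive ones are those with $\gcd(k,N)=1$. *)

theory Defs
  imports Complex_Main "HOL-Algebra.Generated_Fields" "HOL-Algebra.Algebraic_Closure_Type"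
begin

definition gon_s :: "nat \<Rightarrow> nat \<Rightarrow> real" where
  "gon_s N k = tan (real k * pi / real N)"

definition gon_scale :: "nat \<Rightarrow> nat \<Rightarrow> real" where
  "gon_scale N k = gon_s N 1 / gon_s N k"

text \<open>The scales are viewed inside the complex numbers, where the cyclotomic field lives.\<close>

definition primitive_scales :: "nat \<Rightarrow> complex set" where
  "primitive_scales N =
     {complex_of_real (gon_scale N k) | k. 1 \<le> k \<and> real k < real N / 2 \<and> gcd k N = 1}"

definition zeta :: "nat \<Rightarrow> complex" where
  "zeta N = exp (2 * complex_of_real pi * \<i> / of_nat N)"

text \<open>A subfield of the complex numbers contains the rationals, so the subfield generated by
  a number \<open>x\<close> is the field obtained by adjoining \<open>x\<close> to the rationals.\<close>

definition real_cyclotomic_field :: "nat \<Rightarrow> complex set" where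
  "real_cyclotomic_field N =
     generate_field (ring_of_type_algebra :: complex ring) {zeta N + inverse (zeta N)}"

definition ring_of_integers :: "complex set \<Rightarrow> complex ring" where
  "ring_of_integers K = ring_of_type_algebra\<lparr>carrier := {x \<in> K. algebraic_int x}\<rparr>"

definition rat_scale :: "rat \<Rightarrow> complex \<Rightarrow> complex" where
  "rat_scale q x = of_rat q * x"

global_interpretation rat_vs: vector_space rat_scale
  by unfold_locales (simp_all add: rat_scale_def algebra_simps of_rat_add of_rat_mult)

definition is_rat_basis :: "complex set \<Rightarrow> complex set \<Rightarrow> bool" where
  "is_rat_basis B V \<longleftrightarrow> rat_vs.independent B \<and> rat_vs.span B = V"

end

theory Submission
  imports Defs "HOL-Analysis.Analysis" "HOL-Number_Theory.Number_Theory" "Jordan_Normal_Form.Char_Poly"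
begin

text \<open>
  Up to the common factor \<open>tan (\<pi>/N)\<close> the primitive scales are the numbers \<open>cot (k\<pi>/N)\<close>, and
  \<open>cot (k\<pi>/N) = i Q(\<zeta>^k)\<close> for a rational polynomial \<open>Q\<close>. By irreducibility of the cyclotomic
  polynomial, a rational linear relation between them survives every substitution \<open>\<zeta> \<mapsto> \<zeta>^j\<close>; its
  coefficients, extended to an odd function on the units modulo \<open>N\<close>, thus lie in a space of functions
  that is invariant under all shifts \<open>k \<mapsto> g k\<close>. If that space were nonzero it would contain a common
  eigenvector of the shifts, i.e. an odd Dirichlet character \<open>\<chi>\<close> with \<open>\<Sum> \<chi>(j) cot (j\<pi>/N) = 0\<close>. By the
  partial fraction expansion of the cotangent this says \<open>L(1, \<chi>) = 0\<close>, which is impossible: for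
  \<open>\<chi>\<^sup>2 \<noteq> 1\<close> by the \<open>3-4-1\<close> inequality for \<open>s \<down> 1\<close>, and for real \<open>\<chi>\<close> by Monsky's argument with the
  Lambert series of \<open>\<chi>\<close>. Spanning follows by counting: \<open>V \<inter> (\<zeta> - \<zeta>^-1) V = 0\<close> inside \<open>\<rat>(\<zeta>)\<close> for the real
  subfield \<open>V\<close>, so \<open>V\<close> has dimension at most \<open>\<phi>(N)/2\<close>, the number of primitive scales. They are units
  because \<open>(\<zeta>^k - 1)/(\<zeta> - 1)\<close>, \<open>(\<zeta>^k + 1)/(\<zeta> + 1)\<close> and their inverses are values of geometric sums.
\<close>

section \<open>Nonvanishing of Dirichlet L-functions at 1\<close>

text \<open>A single linear relation is not stable under the shifts; the whole family of its Galois
  conjugates is, which is why irreducibility enters before any character does. Nothing is known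
  about the conductor of the resulting character, so all arguments allow imprimitive characters.
  Oddness comes from cot(-x) = -cot(x), and it makes the cotangent sum a multiple of L(1, \<chi>):
  in the partial fractions the contributions of j and N - j reinforce each other. The split between
  complex and real characters is a matter of balance at s = 1. In the 3-4-1 product a zero of L(s,
  \<chi>) enters with order 4 and the pole of the zeta function with order 3. Both arguments stay on
  the real line, at s > 1 and at x < 1, and reach the boundary by Abel summation.\<close>

lemma bij_betw_mult_mod:
  fixes a N :: nat
  assumes "coprime a N" "N > 0"
  shows "bij_betw (\<lambda>k. (a * k) mod N) {..<N} {..<N}"
proof -
  have inj: "inj_on (\<lambda>k. (a * k) mod N) {..<N}"
  proof (rule inj_onI)
    fix x y assume xy: "x \<in> {..<N}" "y \<in> {..<N}" "(a * x) mod N = (a * y) mod N"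
    hence "[a * x = a * y] (mod N)" by (simp add: cong_def)
    hence "[x = y] (mod N)" using assms(1) by (simp add: cong_mult_lcancel_nat)
    thus "x = y" using xy by (simp add: cong_def)
  qed
  moreover have "(\<lambda>k. (a * k) mod N) ` {..<N} = {..<N}"
    by (rule card_subset_eq) (use assms inj in \<open>auto simp: card_image\<close>)
  ultimately show ?thesis by (simp add: bij_betw_def)
qed

locale dirichlet_char =
  fixes N :: nat and chi :: "nat \<Rightarrow> complex"
  assumes N_pos: "N > 0"
    and mult: "chi (m * n) = chi m * chi n"
    and periodic: "chi (n + N) = chi n"
    and zero_iff: "chi n = 0 \<longleftrightarrow> \<not> coprime n N"
begin

lemma periodic_mult: "chi (n + m * N) = chi n"
proof (induction m)
  case (Suc m)
  have "chi (n + Suc m * N) = chi ((n + m * N) + N)" by (simp add: algebra_simps)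
  with Suc show ?case by (simp only: periodic)
qed auto

lemma mod_eq [simp]: "chi (n mod N) = chi n"
  using periodic_mult[of "n mod N" "n div N"] by (simp add: mult.commute)

lemma one [simp]: "chi 1 = 1" "chi (Suc 0) = 1"
proof -
  have "chi 1 = chi 1 * chi 1" using mult[of 1 1] by simp
  moreover have "chi 1 \<noteq> 0" by (simp add: zero_iff)
  ultimately show "chi 1 = 1" by simp
  thus "chi (Suc 0) = 1" by simp
qed

lemma power: "chi (n ^ k) = chi n ^ k"
  by (induction k) (auto simp: mult)

lemma cong: "[m = n] (mod N) \<Longrightarrow> chi m = chi n"
  by (metis cong_def mod_eq)

lemma norm_coprime: "coprime n N \<Longrightarrow> norm (chi n) = 1"
proof -
  assume n: "coprime n N"
  have "chi (n ^ totient N) = chi 1" using euler_theorem[OF n] by (rule cong)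
  hence "norm (chi n) ^ totient N = 1" by (simp add: power flip: norm_power)
  thus ?thesis using N_pos using power_eq_imp_eq_base[of "norm (chi n)" "totient N" 1] by simp
qed

lemma norm_cases: "norm (chi n) = 1 \<or> chi n = 0"
  using norm_coprime zero_iff by blast

lemma norm_le: "norm (chi n) \<le> 1"
  using norm_cases[of n] by auto

text \<open>Multiplication by \<open>a\<close> permutes the residues, so the sum is unchanged when
  multiplied by \<open>chi a\<close>, which differs from 1.\<close>

lemma sum_block:
  assumes "coprime a N" "chi a \<noteq> 1"
  shows "(\<Sum>k<N. chi k) = 0"
proof -
  have "(\<Sum>k<N. chi k) = (\<Sum>k<N. chi ((a * k) mod N))"
    by (rule sum.reindex_bij_betw[OF bij_betw_mult_mod[OF assms(1) N_pos], symmetric])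
  also have "\<dots> = (\<Sum>k<N. chi a * chi k)" by (simp only: mod_eq mult)
  also have "\<dots> = chi a * (\<Sum>k<N. chi k)" by (simp add: sum_distrib_left)
  finally show ?thesis using assms(2) by simp
qed

lemma partial_sums_bounded:
  assumes "coprime a N" "chi a \<noteq> 1"
  shows "norm (\<Sum>n<M. chi (Suc n)) \<le> real (N + 1)"
proof -
  have blocks: "(\<Sum>n<q * N. chi n) = 0" for q
  proof (induction q)
    case (Suc q)
    have "(\<Sum>n<Suc q * N. chi n) = (\<Sum>n<q * N. chi n) + (\<Sum>n=q*N..<q*N+N. chi n)"
      by (subst lessThan_atLeast0, subst lessThan_atLeast0, subst sum.atLeastLessThan_concat)
         (auto simp: algebra_simps)
    also have "(\<Sum>n=q*N..<q*N+N. chi n) = (\<Sum>n<N. chi (n + q * N))"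
      using sum.shift_bounds_nat_ivl[of chi 0 "q * N" N] by (simp add: lessThan_atLeast0 add.commute)
    also have "\<dots> = 0" using sum_block[OF assms] by (simp add: periodic_mult)
    finally show ?case using Suc by simp
  qed auto
  have *: "norm (\<Sum>n<M. chi n) \<le> real N" for M
  proof -
    have "(\<Sum>n<M. chi n) = (\<Sum>n<(M div N) * N. chi n) + (\<Sum>n=(M div N) * N..<M. chi n)"
      by (subst lessThan_atLeast0, subst lessThan_atLeast0, subst sum.atLeastLessThan_concat) auto
    also have "norm \<dots> = norm (\<Sum>n=(M div N) * N..<M. chi n)" by (simp add: blocks)
    also have "\<dots> \<le> (\<Sum>n=(M div N) * N..<M. 1)"
      by (intro order.trans[OF norm_sum] sum_mono norm_le)
    also have "\<dots> = real (M mod N)" by (simp add: minus_div_mult_eq_mod)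
    also have "\<dots> \<le> real N" using N_pos by (simp add: less_imp_le)
    finally show ?thesis .
  qed
  \<comment> \<open>The Dirichlet series starts at index 1. Passing to sums from 0 costs the term
    \<open>chi 0\<close>, which accounts for \<open>N + 1\<close> instead of
    \<open>N\<close>.\<close>
  have "(\<Sum>n<M. chi (Suc n)) = (\<Sum>n<Suc M. chi n) - chi 0"
    by (subst sum.lessThan_Suc_shift) simp
  also have "norm \<dots> \<le> real N + 1"
    using *[of "Suc M"] norm_le[of 0] norm_triangle_ineq4[of "\<Sum>n<Suc M. chi n" "chi 0"] by linarith
  finally show ?thesis by simp
qed

lemma square: "dirichlet_char N (\<lambda>n. chi n ^ 2)"
  by unfold_locales (auto simp: N_pos mult periodic zero_iff power_mult_distrib)

end

section \<open>Abel summation and Dirichlet series near s = 1\<close>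

text \<open>Summation by parts; the boundary term vanishes in the limit because \<open>g\<close>
  tends to 0. The hypothesis is a majorant \<open>v\<close> of the variation and not monotonicity,
  because the weights n^-s - 1/n used below start at 0, become negative and return to 0.\<close>

lemma abel_summation_bound:
  fixes f :: "nat \<Rightarrow> complex" and g :: "nat \<Rightarrow> real"
  assumes f: "\<And>M. norm (\<Sum>n<M. f n) \<le> B" and g: "g \<longlonglongrightarrow> 0"
    and v: "\<And>n. \<bar>g (Suc n) - g n\<bar> \<le> v n" and sv: "v sums V"
  shows "summable (\<lambda>n. f n * of_real (g n))" "norm (\<Sum>n. f n * of_real (g n)) \<le> B * V"
proof -
  define F where "F = (\<lambda>M. \<Sum>n<M. f n)"
  define h where "h = (\<lambda>n. F (Suc n) * of_real (g n - g (Suc n)))"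
  have part: "(\<Sum>n<M. f n * of_real (g n)) = F M * of_real (g M) + (\<Sum>n<M. h n)" for M
    by (induction M) (auto simp: F_def h_def algebra_simps)
  have B: "B \<ge> 0" using f[of 0] by simp
  have hb: "norm (h n) \<le> B * v n" for n
    unfolding h_def norm_mult norm_of_real using f[of "Suc n"] v[of n] B
    by (intro mult_mono) (auto simp: F_def abs_minus_commute)
  have Bv: "(\<lambda>n. B * v n) sums (B * V)" using sv by (rule sums_mult)
  have sh: "summable (\<lambda>n. norm (h n))"
    by (rule summable_comparison_test'[OF sums_summable[OF Bv]]) (use hb in auto)
  have "(\<lambda>M. F M * of_real (g M)) \<longlonglongrightarrow> 0"
  proof (rule Lim_null_comparison)
    show "\<forall>\<^sub>F M in sequentially. norm (F M * of_real (g M)) \<le> B * \<bar>g M\<bar>"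
      by (intro always_eventually allI) (auto simp: norm_mult F_def intro!: mult_right_mono f)
    show "(\<lambda>M. B * \<bar>g M\<bar>) \<longlonglongrightarrow> 0"
      using tendsto_mult_right_zero[OF tendsto_rabs_zero[OF g]] by simp
  qed
  moreover have "(\<lambda>M. \<Sum>n<M. h n) \<longlonglongrightarrow> suminf h"
    using summable_norm_cancel[OF sh] summable_LIMSEQ by blast
  ultimately have s: "(\<lambda>n. f n * of_real (g n)) sums suminf h"
    unfolding sums_def part using tendsto_add by force
  show "summable (\<lambda>n. f n * of_real (g n))" using s by (rule sums_summable)
  have "norm (suminf h) \<le> (\<Sum>n. norm (h n))" by (rule summable_norm[OF sh])
  also have "\<dots> \<le> B * V"
    using suminf_le[OF hb sh sums_summable[OF Bv]] sums_unique[OF Bv] by simp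
  finally show "norm (\<Sum>n. f n * of_real (g n)) \<le> B * V"
    using sums_unique[OF s] by simp
qed

corollary abel_summation_bound_antimono:
  fixes f :: "nat \<Rightarrow> complex" and g :: "nat \<Rightarrow> real"
  assumes "\<And>M. norm (\<Sum>n<M. f n) \<le> B" "g \<longlonglongrightarrow> 0" "\<And>n. g (Suc n) \<le> g n"
  shows "summable (\<lambda>n. f n * of_real (g n))" "norm (\<Sum>n. f n * of_real (g n)) \<le> B * g 0"
proof -
  have "(\<lambda>n. g n - g (Suc n)) sums (g 0 - 0)" by (rule telescope_sums'[OF assms(2)])
  hence s: "(\<lambda>n. g n - g (Suc n)) sums g 0" by simp
  show "summable (\<lambda>n. f n * of_real (g n))" "norm (\<Sum>n. f n * of_real (g n)) \<le> B * g 0"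
    by (rule abel_summation_bound[OF assms(1,2) _ s]; use assms(3) in auto)+
qed

definition dirichlet_series :: "(nat \<Rightarrow> complex) \<Rightarrow> real \<Rightarrow> complex" where
  "dirichlet_series f s = (\<Sum>n. f (Suc n) * of_real (real (Suc n) powr -s))"

lemma powr_Suc_tendsto_0: "s > 0 \<Longrightarrow> (\<lambda>n. real (Suc n) powr -s) \<longlonglongrightarrow> 0"
  by (rule tendsto_neg_powr[OF _ filterlim_compose[OF filterlim_real_sequentially filterlim_Suc]]) simp_all

context dirichlet_char
begin

lemma dirichlet_series_bounded:
  assumes "coprime a N" "chi a \<noteq> 1" "s > 0"
  shows "norm (dirichlet_series chi s) \<le> real (N + 1)"
proof -
  have "norm (dirichlet_series chi s) \<le> real (N + 1) * (real (Suc 0) powr -s)"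
    unfolding dirichlet_series_def
    by (intro abel_summation_bound_antimono partial_sums_bounded[OF assms(1,2)] powr_Suc_tendsto_0)
       (use assms(3) in \<open>auto simp: powr_mono2'\<close>)
  thus ?thesis by simp
qed

lemma summable_at_1:
  assumes "coprime a N" "chi a \<noteq> 1"
  shows "summable (\<lambda>n. chi (Suc n) / of_nat (Suc n))"
proof -
  have "summable (\<lambda>n. chi (Suc n) * of_real (real (Suc n) powr -1))"
    by (intro abel_summation_bound_antimono(1)[OF partial_sums_bounded[OF assms]] powr_Suc_tendsto_0 powr_mono2') simp_all
  thus ?thesis by (simp add: powr_minus divide_inverse)
qed

end

text \<open>The factor \<open>s - 1\<close> is the point. By the mean value theorem the difference
  is (1 - s y^(1-s)) y^-2 for some y between x and x + 1, and the bracket is at most (s - 1)(ln y +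
  1). Absorbing the logarithm into 2 y^(1/2) leaves the exponent -3/2, which is still
  summable.\<close>

lemma powr_variation:
  fixes s x :: real
  assumes s: "1 < s" and x: "x \<ge> 1"
  shows "\<bar>((x + 1) powr -s - 1 / (x + 1)) - (x powr -s - 1 / x)\<bar> \<le> (s - 1) * (2 * x powr (-3/2))"
proof -
  define d where "d = s - 1"
  define h where "h = (\<lambda>y::real. y powr -s - 1 / y)"
  define h' where "h' = (\<lambda>y::real. -s * y powr (-s - 1) + 1 / y^2)"
  have der: "(h has_real_derivative h' y) (at y)" if "y > 0" for y
    unfolding h_def h'_def using that
    by (auto intro!: derivative_eq_intros simp: power2_eq_square)
  have "\<exists>y. x < y \<and> y < x + 1 \<and> h (x + 1) - h x = (x + 1 - x) * h' y"
    using x by (intro MVT2 der) auto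
  then obtain y where y: "x < y" "h (x + 1) - h x = h' y" by auto
  have y1: "y > 1" using x y by simp
  have "h' y = (1 - s * y powr -d) * y powr -2"
  proof -
    have "y powr (-s - 1) = y powr -d * y powr -2"
      unfolding powr_add [symmetric] by (rule arg_cong[of _ _ "(powr) y"]) (simp add: d_def)
    moreover have "1 / y ^ 2 = y powr -2" using y1 by (simp add: powr_minus_divide)
    ultimately show ?thesis by (simp add: h'_def algebra_simps)
  qed
  moreover have "\<bar>1 - s * y powr -d\<bar> \<le> d * (2 * y powr (1/2))"
  proof -
    have a: "y powr -d \<le> 1" using y1 s powr_mono[of "-d" 0 y] by (simp add: d_def)
    have b: "1 - d * ln y \<le> y powr -d"
      using exp_ge_add_one_self[of "-d * ln y"] y1 by (simp add: powr_def)
    have c: "ln y \<le> 2 * y powr (1/2) - 2"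
      using ln_add_one_self_le_self2[of "y powr (1/2) - 1"] y1 by (simp add: ln_powr)
    have "1 - s * y powr -d = (1 - y powr -d) - d * y powr -d" by (simp add: d_def algebra_simps)
    hence "\<bar>1 - s * y powr -d\<bar> \<le> \<bar>1 - y powr -d\<bar> + \<bar>d * y powr -d\<bar>" by linarith
    also have "\<dots> = (1 - y powr -d) + d * y powr -d" using a s by (simp add: d_def abs_mult)
    also have "\<dots> \<le> d * ln y + d * 1" using a b s by (intro add_mono mult_left_mono) (auto simp: d_def)
    also have "\<dots> = d * (ln y + 1)" by (simp add: algebra_simps)
    also have "\<dots> \<le> d * (2 * y powr (1/2))" using c s by (intro mult_left_mono) (auto simp: d_def)
    finally show ?thesis .
  qed
  ultimately have "\<bar>h' y\<bar> \<le> d * (2 * y powr (1/2)) * y powr -2"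
    by (simp add: abs_mult mult_right_mono)
  also have "\<dots> = d * (2 * y powr (-3/2))" using y1 by (simp add: flip: powr_add)
  also have "\<dots> \<le> d * (2 * x powr (-3/2))"
    using y x s by (intro mult_left_mono powr_mono2') (auto simp: d_def)
  finally show ?thesis using y by (simp add: h_def d_def)
qed

text \<open>Subtracting the vanishing series at 1 replaces the weights n^-s by n^-s - 1/n, whose
  total variation is O(s - 1). This gives a zero of order at least one without differentiating the
  series.\<close>

lemma (in dirichlet_char) dirichlet_series_zero_at_1:
  assumes "coprime a N" "chi a \<noteq> 1" and zero: "(\<lambda>n. chi (Suc n) / of_nat (Suc n)) sums 0"
  obtains C where "\<And>s. s > 1 \<Longrightarrow> norm (dirichlet_series chi s) \<le> C * (s - 1)"
proof -
  define V where "V = (\<Sum>n. 2 * real (Suc n) powr (-3/2))"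
  have "summable (\<lambda>n. real n powr (-3/2))" by (simp add: summable_real_powr_iff)
  hence "summable (\<lambda>n. 2 * real (Suc n) powr (-3/2))"
    by (intro summable_mult) (subst summable_Suc_iff)
  hence V: "(\<lambda>n. 2 * real (Suc n) powr (-3/2)) sums V" by (simp add: V_def summable_sums)
  show ?thesis
  proof (rule that)
    fix s :: real assume s: "s > 1"
    define g where "g = (\<lambda>n. real (Suc n) powr -s - 1 / real (Suc n))"
    have g0: "g \<longlonglongrightarrow> 0"
      unfolding g_def using tendsto_diff[OF powr_Suc_tendsto_0[of s] powr_Suc_tendsto_0[of 1]] s
      by (simp add: powr_minus_divide)
    have v: "\<bar>g (Suc n) - g n\<bar> \<le> (s - 1) * (2 * real (Suc n) powr (-3/2))" for n
      using powr_variation[OF s, of "real (Suc n)"] by (simp add: g_def add_ac)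
    note ab = abel_summation_bound[OF partial_sums_bounded[OF assms(1,2)] g0 v sums_mult[OF V]]
    have "(\<lambda>n. chi (Suc n) * of_real (g n) + chi (Suc n) / of_nat (Suc n)) sums
            ((\<Sum>n. chi (Suc n) * of_real (g n)) + 0)"
      by (intro sums_add zero summable_sums ab)
    also have "(\<lambda>n. chi (Suc n) * of_real (g n) + chi (Suc n) / of_nat (Suc n)) =
        (\<lambda>n. chi (Suc n) * of_real (real (Suc n) powr -s))"
      by (auto simp: g_def algebra_simps)
    finally have "dirichlet_series chi s = (\<Sum>n. chi (Suc n) * of_real (g n))"
      by (simp add: dirichlet_series_def sums_iff)
    thus "norm (dirichlet_series chi s) \<le> (real (N + 1) * V) * (s - 1)"
      using ab(2) by (simp add: mult_ac)
  qed
qed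

section \<open>Euler products and the 3-4-1 inequality\<close>

text \<open>Sieving by one more prime q removes the multiples of q. A factor q does not affect
  divisibility by the other primes, so these multiples contribute \<open>f q\<close> times the
  current sum, and the sum is multiplied by \<open>1 - f q\<close>.\<close>

lemma sieve_completely_multiplicative:
  fixes f :: "nat \<Rightarrow> complex"
  assumes mult: "\<And>m n. f (m * n) = f m * f n" and sm: "summable f"
    and P: "finite P" "\<And>p. p \<in> P \<Longrightarrow> prime p"
  shows "(\<lambda>n. if \<exists>p\<in>P. p dvd n then 0 else f n) sums ((\<Prod>p\<in>P. 1 - f p) * suminf f)"
  using P
proof (induction P rule: finite_induct)
  case empty
  thus ?case using sm by (simp add: summable_sums)
next
  case (insert q P)
  define g where "g = (\<lambda>n. if \<exists>p\<in>P. p dvd n then 0 else f n)"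
  define S where "S = (\<Prod>p\<in>P. 1 - f p) * suminf f"
  have g: "g sums S" using insert by (simp add: g_def S_def)
  have q: "prime q" using insert by auto
  have gq: "g (q * m) = f q * g m" for m
  proof -
    have "p dvd q * m \<longleftrightarrow> p dvd m" if "p \<in> P" for p
    proof -
      have "prime p" "p \<noteq> q" using that insert by auto
      thus ?thesis using q by (auto simp: prime_dvd_mult_iff dest: primes_dvd_imp_eq)
    qed
    thus ?thesis by (auto simp: g_def mult)
  qed
  have "(\<lambda>m. g (q * m)) sums (f q * S)" using sums_mult[OF g, of "f q"] by (simp add: gq)
  also have "(\<lambda>m. g (q * m)) = (\<lambda>m. (\<lambda>n. if q dvd n then g n else 0) (q * m))" by simp
  finally have "(\<lambda>n. if q dvd n then g n else 0) sums (f q * S)"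
  proof (subst (asm) sums_mono_reindex)
    show "strict_mono (\<lambda>m. q * m)" using q by (auto simp: strict_mono_def prime_gt_0_nat)
  qed auto
  from sums_diff[OF g this] have "(\<lambda>n. g n - (if q dvd n then g n else 0)) sums (S - f q * S)" .
  also have "(\<lambda>n. g n - (if q dvd n then g n else 0)) =
      (\<lambda>n. if \<exists>p\<in>insert q P. p dvd n then 0 else f n)" by (auto simp: g_def)
  also have "S - f q * S = (\<Prod>p\<in>insert q P. 1 - f p) * suminf f"
    using insert by (simp add: S_def algebra_simps)
  finally show ?case .
qed

text \<open>After sieving by all primes up to y only the term at 1 survives below y, so the error is
  bounded by a tail of the absolutely convergent series. Stating the limit for product times series
  avoids dividing by Euler factors.\<close>

lemma euler_product:
  fixes f :: "nat \<Rightarrow> complex"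
  assumes mult: "\<And>m n. f (m * n) = f m * f n" and f0: "f 0 = 0" and f1: "f 1 = 1"
    and sm: "summable (\<lambda>n. norm (f n))"
  shows "(\<lambda>y. (\<Prod>p | prime p \<and> p \<le> y. 1 - f p) * suminf f) \<longlonglongrightarrow> 1"
proof (rule Lim_null[THEN iffD2], rule Lim_null_comparison)
  show "(\<lambda>y. \<Sum>n. norm (f (n + y))) \<longlonglongrightarrow> 0"
    using suminf_exist_split2[OF sm] by simp
  show "\<forall>\<^sub>F y in sequentially. norm ((\<Prod>p | prime p \<and> p \<le> y. 1 - f p) * suminf f - 1)
          \<le> (\<Sum>n. norm (f (n + y)))"
    using eventually_ge_at_top[of 2]
  proof eventually_elim
    fix y :: nat assume y: "y \<ge> 2"
    define P where "P = {p. prime p \<and> p \<le> y}"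
    define g where "g = (\<lambda>n. if \<exists>p\<in>P. p dvd n then 0 else f n)"
    have "finite P" unfolding P_def by (rule finite_subset[of _ "{..y}"]) auto
    hence g: "g sums ((\<Prod>p\<in>P. 1 - f p) * suminf f)" unfolding g_def
      by (intro sieve_completely_multiplicative mult summable_norm_cancel[OF sm]) (auto simp: P_def)
    have small: "g n = (if n = 1 then 1 else 0)" if "n < y" for n
    proof (cases "n \<le> 1")
      case True
      hence "n = 0 \<or> n = 1" by auto
      thus ?thesis using f0 f1 by (auto simp: g_def P_def)
    next
      case False
      then obtain p where "prime p" "p dvd n" using prime_factor_nat[of n] by auto
      moreover from this have "p \<le> n" using False by (intro dvd_imp_le) auto
      ultimately show ?thesis using False that by (auto simp: g_def P_def intro!: bexI[of _ p])
    qed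
    have "(\<Sum>n<y. g n) = (\<Sum>n<y. if n = 1 then 1 else 0)" by (intro sum.cong small) auto
    also have "\<dots> = 1" using y by (subst sum.delta) auto
    finally have "(\<Prod>p\<in>P. 1 - f p) * suminf f - 1 = (\<Sum>n. g (n + y))"
      using suminf_split_initial_segment[OF sums_summable[OF g], of y] sums_unique[OF g] by simp
    also have "norm \<dots> \<le> (\<Sum>n. norm (f (n + y)))"
    proof (rule order.trans[OF summable_norm suminf_le])
      have sf: "summable (\<lambda>n. norm (f (n + y)))" using sm by (subst summable_iff_shift)
      show le: "norm (g (n + y)) \<le> norm (f (n + y))" for n by (auto simp: g_def)
      show "summable (\<lambda>n. norm (g (n + y)))"
        by (rule summable_comparison_test'[OF sf]) (use le in auto)
      thus "summable (\<lambda>n. norm (g (n + y)))" .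
      show "summable (\<lambda>n. norm (f (n + y)))" by fact
    qed
    finally show "norm ((\<Prod>p | prime p \<and> p \<le> y. 1 - f p) * suminf f - 1)
          \<le> (\<Sum>n. norm (f (n + y)))" unfolding P_def .
  qed
qed

lemma Re_complex_of_real_mult: "Re (complex_of_real x * z) = x * Re z"
  by simp

lemma three_four_one:
  fixes t :: real and z :: complex
  assumes t: "0 \<le> t" "t < 1" and z: "norm z = 1 \<or> z = 0"
  shows "norm ((1 - of_real t) ^ 3 * (1 - of_real t * z) ^ 4 * (1 - of_real t * z\<^sup>2)) \<le> 1"
proof (cases "z = 0")
  case True
  have "(1 - t) ^ 3 \<le> 1" using t by (intro power_le_one) auto
  moreover have "norm ((1 - of_real t :: complex) ^ 3) = (1 - t) ^ 3"
  proof -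
    have "norm (of_real (1 - t) :: complex) = 1 - t" using t by (simp only: norm_of_real)
    thus ?thesis by (simp add: norm_power)
  qed
  ultimately show ?thesis using True by simp
next
  case False
  hence z1: "norm z = 1" using z by auto
  \<comment> \<open>The term k = 0 of this logarithm series is 0 because division by zero yields
    zero.\<close>
  have lnorm: "(\<lambda>k. - (t ^ k / real k) * Re (w ^ k)) sums ln (norm (1 - of_real t * w))"
    if w: "norm w = 1" for w :: complex
  proof -
    have n: "norm (- (of_real t * w)) < 1" using t w by (simp add: norm_mult)
    have nz: "1 - of_real t * w \<noteq> 0"
    proof
      assume "1 - of_real t * w = 0"
      hence "of_real t * w = 1" by simp
      with n show False by simp
    qed
    have "(-1) ^ k * (- (of_real t * w)) ^ k = of_real (t ^ k) * w ^ k" for k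
      by (simp flip: power_mult_distrib)
    hence "(-1) ^ Suc k / of_nat k * (- (of_real t * w)) ^ k = of_real (- (t ^ k / real k)) * w ^ k" for k
      by (simp add: field_simps)
    hence eq: "Re ((-1) ^ Suc k / of_nat k * (- (of_real t * w)) ^ k) = - (t ^ k / real k) * Re (w ^ k)" for k
      by (simp only: Re_complex_of_real_mult)
    from sums_Re[OF Ln_series[OF n]] show ?thesis
      unfolding eq using nz by (simp add: Re_Ln)
  qed
  let ?f = "\<lambda>k. 3 * (- (t ^ k / real k) * Re (1 ^ k)) + 4 * (- (t ^ k / real k) * Re (z ^ k))
          + - (t ^ k / real k) * Re ((z\<^sup>2) ^ k)"
  let ?S = "3 * ln (norm (1 - of_real t * 1 :: complex)) + 4 * ln (norm (1 - of_real t * z))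
          + ln (norm (1 - of_real t * z\<^sup>2))"
  have z2: "norm (z\<^sup>2) = 1" by (simp add: norm_power z1)
  have sums: "?f sums ?S"
    by (rule sums_add[OF sums_add[OF sums_mult[OF lnorm[OF norm_one]] sums_mult[OF lnorm[OF z1]]]
          lnorm[OF z2]])
  have f_le: "?f k \<le> 0" for k
  proof -
    define u where "u = z ^ k"
    have u: "norm u = 1" by (simp add: u_def norm_power z1)
    hence "Re u ^ 2 + Im u ^ 2 = 1" by (simp add: cmod_def)
    hence "3 + 4 * Re u + Re (u\<^sup>2) = 2 * (1 + Re u)\<^sup>2"
      by (simp add: power2_eq_square algebra_simps)
    hence "0 \<le> t ^ k / real k * (3 + 4 * Re u + Re (u\<^sup>2))" using t by simp
    also have "u\<^sup>2 = (z\<^sup>2) ^ k" by (simp add: u_def flip: power_mult) (simp add: mult.commute)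
    finally show ?thesis by (simp add: u_def algebra_simps)
  qed
  have S: "?S \<le> 0" by (rule sums_le[OF f_le sums sums_zero])
  have pos: "norm (1 - of_real t * w) > 0" if "norm w = 1" for w :: complex
  proof -
    have "norm (of_real t * w) < norm (1 :: complex)" using that t by (simp add: norm_mult)
    thus ?thesis by auto
  qed
  have "norm ((1 - of_real t) ^ 3 * (1 - of_real t * z) ^ 4 * (1 - of_real t * z\<^sup>2)) = exp ?S"
  proof -
    have e: "exp (real n * ln x) = x ^ n" if "x > 0" for n and x :: real
      using that by (simp add: exp_of_nat_mult)
    have "exp ?S = norm (1 - of_real t * 1 :: complex) ^ 3 * norm (1 - of_real t * z) ^ 4
        * norm (1 - of_real t * z\<^sup>2)"
      using e[of "norm (1 - of_real t * 1 :: complex)" 3] e[of "norm (1 - of_real t * z)" 4]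
        pos[of 1] pos[of z] pos[of "z\<^sup>2"] z1
      by (simp only: exp_add of_nat_numeral exp_ln norm_one norm_power power_one)
    thus ?thesis by (simp only: norm_mult norm_power mult_1_right)
  qed
  thus ?thesis using S by simp
qed

lemma zeta_upper_bound:
  fixes s :: real assumes s: "s > 1"
  shows "summable (\<lambda>n. real (Suc n) powr -s)" "(\<Sum>n. real (Suc n) powr -s) \<le> s / (s - 1)"
proof -
  have "summable (\<lambda>n. real n powr -s)" using s by (simp add: summable_real_powr_iff)
  thus sm: "summable (\<lambda>n. real (Suc n) powr -s)" by (subst summable_Suc_iff)
  \<comment> \<open>\<open>h n\<close> is the integral of x^-s from n + 1 to infinity. The
    comparison telescopes to \<open>h 0\<close> = 1/(s - 1), and the first term 1 of the series
    completes this to s/(s - 1).\<close>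
  define h where "h = (\<lambda>n. real (Suc n) powr (1 - s) / (s - 1))"
  have h0: "h \<longlonglongrightarrow> 0"
    using tendsto_divide[OF powr_Suc_tendsto_0[of "s - 1"] tendsto_const[of "s - 1"]] s
    by (simp add: h_def)
  have bound: "real (Suc (Suc n)) powr -s \<le> h n - h (Suc n)" for n
  proof -
    have "\<exists>y. real (Suc n) < y \<and> y < real (Suc (Suc n)) \<and>
       - (real (Suc (Suc n)) powr (1 - s) / (s - 1)) - - (real (Suc n) powr (1 - s) / (s - 1)) =
       (real (Suc (Suc n)) - real (Suc n)) * y powr -s"
      using s by (intro MVT2) (auto intro!: derivative_eq_intros simp: divide_simps, simp add: algebra_simps)
    then obtain y where y: "real (Suc n) < y" "y < real (Suc (Suc n))" "h n - h (Suc n) = y powr -s"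
      by (auto simp: h_def)
    show ?thesis using y s by (simp only: y(3)) (rule powr_mono2', auto)
  qed
  have tel: "(\<lambda>n. h n - h (Suc n)) sums (h 0 - 0)" by (rule telescope_sums'[OF h0])
  have sm': "summable (\<lambda>n. real (Suc (Suc n)) powr -s)" using sm by (subst summable_Suc_iff)
  have "(\<Sum>n. real (Suc n) powr -s) = (\<Sum>n. real (Suc (Suc n)) powr -s) + 1"
    using suminf_split_head[OF sm] by simp
  also have "\<dots> \<le> h 0 + 1"
    using suminf_le[OF bound sm' sums_summable[OF tel]] sums_unique[OF tel] by simp
  also have "\<dots> = s / (s - 1)" using s by (simp add: h_def field_simps)
  finally show "(\<Sum>n. real (Suc n) powr -s) \<le> s / (s - 1)" .
qed

context dirichlet_char
begin

lemma euler_product_dirichlet_series: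
  assumes s: "s > 1"
  shows "(\<lambda>y. (\<Prod>p | prime p \<and> p \<le> y. 1 - chi p * of_real (real p powr -s)) * dirichlet_series chi s)
           \<longlonglongrightarrow> 1"
proof -
  define f where "f = (\<lambda>n. chi n * of_real (real n powr -s))"
  have sm: "summable (\<lambda>n. norm (f n))"
  proof (rule summable_comparison_test')
    show "summable (\<lambda>n. real n powr -s)" using s by (simp add: summable_real_powr_iff)
    show "norm (norm (f n)) \<le> real n powr -s" for n
      using norm_le[of n] by (simp add: f_def norm_mult mult_left_le_one_le)
  qed
  have "dirichlet_series chi s = suminf f"
    using suminf_split_head[OF summable_norm_cancel[OF sm]]
    by (simp add: dirichlet_series_def f_def)
  moreover have "(\<lambda>y. (\<Prod>p | prime p \<and> p \<le> y. 1 - f p) * suminf f) \<longlonglongrightarrow> 1"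
    by (rule euler_product[OF _ _ _ sm]) (auto simp: f_def mult powr_mult)
  ultimately show ?thesis by (simp add: f_def)
qed

text \<open>Each of the three series times its partial Euler product tends to 1. The combined
  partial product has norm at most 1 by the primewise inequality, so the norm of the combined series
  cannot be below the limit 1.\<close>

lemma three_four_one_dirichlet_series:
  assumes s: "s > 1"
  shows "1 \<le> norm (dirichlet_series (\<lambda>_. 1) s ^ 3 * dirichlet_series chi s ^ 4
                    * dirichlet_series (\<lambda>n. chi n ^ 2) s)"
proof -
  interpret triv: dirichlet_char 1 "\<lambda>_. 1" by unfold_locales auto
  interpret sq: dirichlet_char N "\<lambda>n. chi n ^ 2" by (rule square)
  define A where "A = dirichlet_series (\<lambda>_. 1) s"
  define B where "B = dirichlet_series chi s"
  define D where "D = dirichlet_series (\<lambda>n. chi n ^ 2) s"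
  define P where "P = (\<lambda>y::nat. {p. prime p \<and> p \<le> y})"
  define t where "t = (\<lambda>p::nat. real p powr -s)"
  let ?F = "\<lambda>y. norm (((\<Prod>p\<in>P y. 1 - 1 * of_real (t p)) * A) ^ 3
         * ((\<Prod>p\<in>P y. 1 - chi p * of_real (t p)) * B) ^ 4
         * ((\<Prod>p\<in>P y. 1 - chi p ^ 2 * of_real (t p)) * D))"
  note L = triv.euler_product_dirichlet_series[OF s, folded A_def t_def P_def]
    euler_product_dirichlet_series[OF s, folded B_def t_def P_def]
    sq.euler_product_dirichlet_series[OF s, folded D_def t_def P_def]
  have lim: "?F \<longlonglongrightarrow> 1"
    using tendsto_norm[OF tendsto_mult[OF tendsto_mult[OF
        tendsto_power[OF L(1), of 3] tendsto_power[OF L(2), of 4]] L(3)]]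
    by (simp only: power_one mult_1_left norm_one P_def t_def)
  have "?F y \<le> norm (A ^ 3 * B ^ 4 * D)" for y
  proof -
    have "?F y = norm ((\<Prod>p\<in>P y. (1 - of_real (t p)) ^ 3 * (1 - chi p * of_real (t p)) ^ 4
        * (1 - chi p ^ 2 * of_real (t p))) * (A ^ 3 * B ^ 4 * D))"
    proof -
      have "(u * A) ^ 3 * (v * B) ^ 4 * (w * D) = (u ^ 3 * v ^ 4 * w) * (A ^ 3 * B ^ 4 * D)"
        for u v w :: complex by (simp add: power_mult_distrib)
      note eq = this
      show ?thesis
        by (simp only: prod.distrib prod_power_distrib[symmetric] mult_1_left eq)
    qed
    also have "\<dots> \<le> 1 * norm (A ^ 3 * B ^ 4 * D)"
      unfolding norm_mult[of "prod _ _"]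
    proof (rule mult_right_mono)
      show "norm (\<Prod>p\<in>P y. (1 - of_real (t p)) ^ 3 * (1 - chi p * of_real (t p)) ^ 4
        * (1 - chi p ^ 2 * of_real (t p))) \<le> 1"
        unfolding prod_norm[symmetric]
      proof (rule prod_le_1, rule conjI[OF norm_ge_zero])
        fix p assume "p \<in> P y"
        hence "real p > 1" by (auto simp: P_def prime_gt_Suc_0_nat)
        hence "t p < 1" using s powr_less_mono[of "-s" 0 "real p"] by (simp add: t_def)
        moreover have "t p \<ge> 0" by (simp add: t_def)
        ultimately have "norm ((1 - of_real (t p)) ^ 3 * (1 - of_real (t p) * chi p) ^ 4
          * (1 - of_real (t p) * chi p ^ 2)) \<le> 1" by (intro three_four_one norm_cases)
        thus "norm ((1 - of_real (t p)) ^ 3 * (1 - chi p * of_real (t p)) ^ 4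
          * (1 - chi p ^ 2 * of_real (t p))) \<le> 1"
          by (simp only: mult.commute[of "of_real (t p)" "chi p"] mult.commute[of "of_real (t p)" "chi p ^ 2"])
      qed
    qed (rule norm_ge_zero)
    finally show ?thesis by (simp only: mult_1_left)
  qed
  hence "1 \<le> norm (A ^ 3 * B ^ 4 * D)" by (intro LIMSEQ_le_const2[OF lim] exI[of _ 0] allI impI)
  thus ?thesis by (simp only: A_def B_def D_def)
qed

text \<open>As s decreases to 1, the cube of the zeta function is O((s - 1)^-3), the assumed zero
  makes the fourth power O((s - 1)^4), and the series of the squared character stays bounded since
  that character is nontrivial at \<open>a\<close>. The product tends to 0 although its norm is at
  least 1.\<close>

lemma nonvanishing_complex:
  assumes a: "coprime a N" "chi a ^ 2 \<noteq> 1"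
  shows "\<not> (\<lambda>n. chi (Suc n) / of_nat (Suc n)) sums 0"
proof
  assume zero: "(\<lambda>n. chi (Suc n) / of_nat (Suc n)) sums 0"
  interpret sq: dirichlet_char N "\<lambda>n. chi n ^ 2" by (rule square)
  have a1: "chi a \<noteq> 1" using a by auto
  obtain C where C: "\<And>s. s > 1 \<Longrightarrow> norm (dirichlet_series chi s) \<le> C * (s - 1)"
    using dirichlet_series_zero_at_1[OF a(1) a1 zero] by blast
  have bound: "1 \<le> s ^ 3 * C ^ 4 * real (N + 1) * (s - 1)" if s: "s > 1" for s
  proof -
    have Z: "norm (dirichlet_series (\<lambda>_. 1) s) \<le> s / (s - 1)"
    proof -
      have "dirichlet_series (\<lambda>_. 1) s = of_real (\<Sum>n. real (Suc n) powr -s)"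
        unfolding dirichlet_series_def using suminf_of_real[OF zeta_upper_bound(1)[OF s], where 'a = complex] by simp
      moreover have "(\<Sum>n. real (Suc n) powr -s) \<ge> 0" by (intro suminf_nonneg zeta_upper_bound(1) s) auto
      ultimately show ?thesis using zeta_upper_bound(2)[OF s] by simp
    qed
    have C0: "0 \<le> C * (s - 1)" using C[OF s] norm_ge_zero order_trans by blast
    have "1 \<le> norm (dirichlet_series (\<lambda>_. 1) s) ^ 3 * norm (dirichlet_series chi s) ^ 4
                    * norm (dirichlet_series (\<lambda>n. chi n ^ 2) s)"
      using three_four_one_dirichlet_series[OF s] by (simp add: norm_mult norm_power)
    also have "\<dots> \<le> (s / (s - 1)) ^ 3 * (C * (s - 1)) ^ 4 * real (N + 1)"
      using s C0 a by (intro mult_mono power_mono Z C sq.dirichlet_series_bounded[of a]) auto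
    also have "\<dots> = s ^ 3 * C ^ 4 * real (N + 1) * (s - 1)"
    proof -
      have "(s / d) ^ 3 * (C * d) ^ 4 = s ^ 3 * C ^ 4 * d" if "d \<noteq> 0" for d
        using that by (simp add: power_mult_distrib power_divide power_eq_if)
      from this[of "s - 1"] s show ?thesis by simp
    qed
    finally show ?thesis .
  qed
  have lim: "((\<lambda>s::real. s ^ 3 * C ^ 4 * real (N + 1) * (s - 1)) \<longlongrightarrow>
      1 ^ 3 * C ^ 4 * real (N + 1) * (1 - 1)) (at_right 1)"
    by (intro tendsto_intros)
  have "\<forall>\<^sub>F s in at_right (1::real). 1 \<le> s ^ 3 * C ^ 4 * real (N + 1) * (s - 1)"
    using eventually_at_right_less by eventually_elim (rule bound)
  from tendsto_lowerbound[OF lim this] show False by simp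
qed

end

section \<open>Real characters: divisor sums and Lambert series\<close>

definition divisor_sum :: "(nat \<Rightarrow> real) \<Rightarrow> nat \<Rightarrow> real" where
  "divisor_sum f m = (\<Sum>d | d dvd m. f d)"

lemma divisor_sum_mult:
  assumes mult: "\<And>m n. f (m * n) = f m * f n" and cop: "coprime a b" and nz: "a \<noteq> 0" "b \<noteq> 0"
  shows "divisor_sum f (a * b) = divisor_sum f a * divisor_sum f b"
proof -
  have "inj_on (\<lambda>(d, e). d * e) ({d. d dvd a} \<times> {e. e dvd b})"
  proof (rule inj_onI, clarsimp)
    fix d e d' e' assume *: "d dvd a" "e dvd b" "d' dvd a" "e' dvd b" and eq: "d * e = d' * e'"
    have "coprime d e'" "coprime d' e"
      using * cop coprime_divisors by blast+
    moreover have "d dvd d' * e'" "d' dvd d * e" using eq by (metis dvd_triv_left)+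
    ultimately have "d dvd d'" "d' dvd d" by (simp_all add: coprime_dvd_mult_left_iff)
    hence "d = d'" by (rule dvd_antisym)
    moreover have "d \<noteq> 0" using * nz by auto
    ultimately show "d = d' \<and> e = e'" using eq by auto
  qed
  moreover have "(\<lambda>(d, e). d * e) ` ({d. d dvd a} \<times> {e. e dvd b}) = {d. d dvd a * b}"
  proof (intro equalityI subsetI)
    fix n assume "n \<in> {d. d dvd a * b}"
    then obtain d e where "n = d * e" "d dvd a" "e dvd b" using division_decomp[of n a b] by blast
    thus "n \<in> (\<lambda>(d, e). d * e) ` ({d. d dvd a} \<times> {e. e dvd b})" by blast
  qed (auto intro: mult_dvd_mono)
  ultimately have "bij_betw (\<lambda>(d, e). d * e) ({d. d dvd a} \<times> {e. e dvd b}) {d. d dvd a * b}"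
    by (simp only: bij_betw_def)
  from sum.reindex_bij_betw[OF this, of f]
  have "divisor_sum f (a * b) = (\<Sum>(d, e)\<in>{d. d dvd a} \<times> {e. e dvd b}. f (d * e))"
    by (simp only: divisor_sum_def case_prod_unfold)
  also have "\<dots> = divisor_sum f a * divisor_sum f b"
    by (simp add: divisor_sum_def sum_product sum.cartesian_product mult)
  finally show ?thesis .
qed

lemma divisor_sum_prime_power:
  assumes "prime p" shows "divisor_sum f (p ^ k) = (\<Sum>i\<le>k. f (p ^ i))"
proof -
  have "{d. d dvd p ^ k} = (\<lambda>i. p ^ i) ` {..k}"
    using assms by (auto simp: divides_primepow_nat)
  moreover have "inj_on (\<lambda>i. p ^ i) {..k}"
    using assms prime_gt_1_nat by (auto simp: inj_on_def)
  ultimately show ?thesis by (simp add: divisor_sum_def sum.reindex)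
qed

text \<open>By multiplicativity only prime powers matter. There the sum is a geometric sum of ratio
  1, 0 or -1, hence k + 1, 1, or 1 and 0 alternately. It vanishes only for odd exponents, which do
  not occur in a square.\<close>

lemma divisor_sum_nonneg:
  assumes mult: "\<And>m n. f (m * n) = f m * f n" and f1: "f 1 = 1"
    and vals: "\<And>n. f n \<in> {-1, 0, 1}" and "m > 0"
  shows "divisor_sum f m \<ge> 0 \<and> ((\<exists>k. m = k\<^sup>2) \<longrightarrow> divisor_sum f m \<ge> 1)"
  using \<open>m > 0\<close>
proof (induction m rule: less_induct)
  case (less m)
  have f_pow: "f (n ^ i) = f n ^ i" for n i by (induction i) (auto simp: mult f1[simplified])
  show ?case
  proof (cases "m = 1")
    case True
    thus ?thesis using f1 by (simp add: divisor_sum_def)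
  next
    case False
    then obtain p where p: "prime p" "p dvd m" using prime_factor_nat[of m] by auto
    have p1: "p > 1" using p prime_gt_1_nat by blast
    define k where "k = multiplicity p m"
    obtain m' where m': "m = p ^ k * m'" "\<not> p dvd m'"
      using multiplicity_decompose'[of m p] less.prems p1 by (auto simp: k_def)
    have k: "k > 0" using p p1 less.prems by (auto simp: k_def multiplicity_gt_zero_iff)
    have m'0: "m' > 0" using m' less.prems by (auto intro!: Nat.gr0I)
    have "1 < p ^ k" using p1 k by (rule one_less_power)
    hence lt: "m' < m" using m' m'0 by simp
    have cop: "coprime (p ^ k) m'" using p m' by (simp add: prime_imp_coprime)
    have eq: "divisor_sum f m = (\<Sum>i\<le>k. f p ^ i) * divisor_sum f m'"
      using p m' m'0 cop by (simp add: divisor_sum_mult[of f, OF mult] divisor_sum_prime_power f_pow)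
    have "(\<Sum>i\<le>k. (-1 :: real) ^ i) = (if even k then 1 else 0)" by (induction k) auto
    hence "(\<Sum>i\<le>k. f p ^ i) =
        (if f p = 1 then real k + 1 else if f p = 0 then 1 else if even k then 1 else 0)"
      using vals[of p] by (auto simp: power_0_left)
    hence sk: "(\<Sum>i\<le>k. f p ^ i) \<ge> 0" "even k \<Longrightarrow> (\<Sum>i\<le>k. f p ^ i) \<ge> 1"
      by auto
    note IH = less.IH[OF lt m'0]
    show ?thesis
    proof (intro conjI impI)
      show "divisor_sum f m \<ge> 0" unfolding eq using sk IH by simp
      assume "\<exists>l. m = l\<^sup>2"
      then obtain l where l: "m = l\<^sup>2" by blast
      have "l \<noteq> 0" using l less.prems by auto
      hence "k = 2 * multiplicity p l"
        using p by (simp add: k_def l prime_elem_multiplicity_power_distrib)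
      hence ek: "even k" by simp
      then obtain j where j: "k = 2 * j" by auto
      have "(p ^ j) ^ 2 = p ^ k" unfolding j power_mult[symmetric] by (simp only: mult.commute)
      hence "(p ^ j) ^ 2 * m' = l ^ 2" using m' l by simp
      hence "(p ^ j) ^ 2 dvd l ^ 2" by (metis dvd_triv_left)
      hence "p ^ j dvd l" by simp
      then obtain l' where l': "l = p ^ j * l'" by auto
      have "p > 0" using p prime_gt_0_nat by blast
      hence "m' = l' ^ 2" using \<open>(p ^ j) ^ 2 * m' = l ^ 2\<close> by (simp add: l' power_mult_distrib)
      hence "divisor_sum f m' \<ge> 1" using IH by auto
      hence "1 * 1 \<le> (\<Sum>i\<le>k. f p ^ i) * divisor_sum f m'" using sk(2)[OF ek]
        by (intro mult_mono) auto
      thus "divisor_sum f m \<ge> 1" by (simp add: eq)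
    qed
  qed
qed

text \<open>The arithmetic-geometric mean inequality applied to the pairs x^i and x^(n-1-i), whose
  product does not depend on i.\<close>

lemma geometric_sum_ge:
  fixes x :: real
  assumes x: "0 < x" "x < 1"
  shows "real n * x powr ((real n - 1) / 2) \<le> (\<Sum>i<n. x ^ i)"
proof -
  have "2 * x powr ((real n - 1) / 2) \<le> x ^ i + x ^ (n - 1 - i)" if "i < n" for i
  proof -
    define u where "u = x powr (real i / 2)"
    define v where "v = x powr (real (n - 1 - i) / 2)"
    have "u * v = x powr ((real n - 1) / 2)"
      unfolding u_def v_def powr_add [symmetric]
      by (rule arg_cong[of _ _ "(powr) x"]) (use that in \<open>simp add: field_simps of_nat_diff\<close>)
    moreover have "u ^ 2 = x ^ i" "v ^ 2 = x ^ (n - 1 - i)"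
      using x by (simp_all add: u_def v_def powr_realpow flip: powr_numeral add: powr_powr)
    ultimately show ?thesis using sum_squares_bound[of u v] by (simp add: mult.assoc)
  qed
  hence "(\<Sum>i<n. 2 * x powr ((real n - 1) / 2)) \<le> (\<Sum>i<n. x ^ i + x ^ (n - 1 - i))"
    by (intro sum_mono) auto
  also have "\<dots> = (\<Sum>i<n. x ^ i) + (\<Sum>i<n. x ^ (n - Suc i))" by (simp add: sum.distrib)
  also have "(\<Sum>i<n. x ^ (n - Suc i)) = (\<Sum>i<n. x ^ i)" by (rule sum.nat_diff_reindex)
  finally show ?thesis by simp
qed

text \<open>If \<open>\<Sum> f(n)/n = 0\<close>, then summing \<open>f\<close> against these weights, which decrease from \<open>1\<close> to \<open>0\<close>,
  gives minus the Lambert series of \<open>f\<close>; Abel summation then bounds the latter uniformly in \<open>x\<close>.\<close>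

definition monsky_weight :: "real \<Rightarrow> nat \<Rightarrow> real" where
  "monsky_weight x n = 1 / (real (Suc n) * (1 - x)) - x ^ Suc n / (1 - x ^ Suc n)"

text \<open>With S_k = (1 - x^k)/(1 - x), the decrease from one weight to the next, multiplied by 1
  - x, is 1/(m(m+1)) - x^m/(S_m S_(m+1)). The mean inequality for geometric sums gives S_m S_(m+1)
  \<ge> m(m+1) x^m, so it is nonnegative.\<close>

lemma monsky_weight_antimono:
  assumes x: "0 < x" "x < 1"
  shows "monsky_weight x (Suc n) \<le> monsky_weight x n"
proof -
  define m where "m = Suc n"
  define S where "S = (\<lambda>k. \<Sum>i<k. x ^ i)"
  have Sx: "1 - x ^ k = (1 - x) * S k" for k
    using x by (simp add: S_def sum_gp_strict)
  have Spos: "S k > 0" if "k > 0" for k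
    unfolding S_def using x that by (intro sum_pos) auto
  have m: "m > 0" by (simp add: m_def)
  have "real m * real (Suc m) * x ^ m \<le> S m * S (Suc m)"
  proof -
    have "(real m * x powr (real m / 2)) * (real (Suc m) * x powr (real m / 2)) \<le> S m * S (Suc m)"
    proof (intro mult_mono)
      have "x powr (real m / 2) \<le> x powr ((real m - 1) / 2)"
        using x by (intro powr_mono') auto
      hence "real m * x powr (real m / 2) \<le> real m * x powr ((real m - 1) / 2)"
        by (intro mult_left_mono) auto
      also have "\<dots> \<le> S m" unfolding S_def by (rule geometric_sum_ge[OF x])
      finally show "real m * x powr (real m / 2) \<le> S m" .
      show "real (Suc m) * x powr (real m / 2) \<le> S (Suc m)"
        unfolding S_def using geometric_sum_ge[OF x, of "Suc m"] by simp
      show "0 \<le> S m" using Spos[OF m] by simp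
    qed auto
    also have "(real m * x powr (real m / 2)) * (real (Suc m) * x powr (real m / 2)) =
        real m * real (Suc m) * (x powr (real m / 2) * x powr (real m / 2))" by (simp only: mult_ac)
    also have "x powr (real m / 2) * x powr (real m / 2) = x ^ m"
      using x by (simp flip: powr_add powr_realpow)
    finally show ?thesis .
  qed
  moreover have "b / d \<le> 1 / c" if "c * b \<le> d" "c > 0" "d > 0" for b c d :: real
    using that by (simp add: field_simps)
  ultimately have "x ^ m / (S m * S (Suc m)) \<le> 1 / (real m * real (Suc m))"
    using Spos[OF m] Spos[of "Suc m"] m by simp
  moreover have "1 / (real m * real (Suc m)) = 1 / real m - 1 / real (Suc m)"
    using m by (simp add: field_simps)
  moreover have "x ^ m / (S m * S (Suc m)) = x ^ m / S m - x ^ Suc m / S (Suc m)"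
  proof -
    have "S (Suc m) - x * S m = 1"
      unfolding S_def sum.lessThan_Suc_shift by (simp add: sum_distrib_left)
    hence "x ^ m = x ^ m * (S (Suc m) - x * S m)" by simp
    thus ?thesis using Spos[OF m] Spos[of "Suc m"] by (simp add: field_simps)
  qed
  ultimately have "0 \<le> (1 / real m - x ^ m / S m) - (1 / real (Suc m) - x ^ Suc m / S (Suc m))"
    by linarith
  hence "0 \<le> ((1 / real m - x ^ m / S m) - (1 / real (Suc m) - x ^ Suc m / S (Suc m))) / (1 - x)"
    using x by simp
  also have "\<dots> = monsky_weight x n - monsky_weight x (Suc n)"
    using x by (simp add: monsky_weight_def Sx m_def[symmetric] diff_divide_distrib mult.commute del: power_Suc)
  finally show ?thesis by simp
qed

lemma monsky_weight_tendsto_0: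
  assumes x: "0 < x" "x < 1" shows "monsky_weight x \<longlonglongrightarrow> 0"
proof -
  have "(\<lambda>n. 1 / (1 - x) * (1 / real (Suc n)) - x ^ Suc n / (1 - x ^ Suc n)) \<longlonglongrightarrow>
     1 / (1 - x) * 0 - 0 / (1 - 0)"
    using x by (intro tendsto_intros LIMSEQ_power_zero[THEN LIMSEQ_Suc] lim_1_over_n[THEN LIMSEQ_Suc]) auto
  thus ?thesis by (simp add: monsky_weight_def[abs_def] mult.commute)
qed

text \<open>Expanding each x^d/(1 - x^d) as a geometric series gives a double sum over pairs (d, k),
  which is regrouped by the product m = d k. The absolute convergence that permits this follows from
  the case of constant coefficients 1.\<close>

lemma lambert_series:
  fixes f :: "nat \<Rightarrow> real"
  assumes x: "0 < x" "x < 1" and f: "\<And>n. \<bar>f n\<bar> \<le> 1"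
  shows "((\<lambda>m. divisor_sum f m * x ^ m) has_sum (\<Sum>n. f (Suc n) * (x ^ Suc n / (1 - x ^ Suc n)))) {1..}"
    "summable (\<lambda>n. f (Suc n) * (x ^ Suc n / (1 - x ^ Suc n)))"
proof -
  define A where "A = (SIGMA d:{1::nat..}. {1::nat..})"
  define B where "B = (SIGMA m:{1::nat..}. {d. d dvd m})"
  define g where "g = (\<lambda>(d, k). f d * x ^ (d * k))"
  have xd: "x ^ d < 1" if "d > 0" for d using x that by (simp add: power_less_one_iff)
  have geo: "((\<lambda>k. x ^ (d * k)) has_sum (x ^ d / (1 - x ^ d))) {1..}" if "d \<in> {1..}" for d
  proof -
    have "(\<lambda>k. (x ^ d) ^ Suc k) sums (x ^ d * (1 / (1 - x ^ d)))"
      unfolding power_Suc using that x xd[of d] by (intro sums_mult geometric_sums) auto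
    hence "((\<lambda>k. (x ^ d) ^ Suc k) has_sum (x ^ d / (1 - x ^ d))) UNIV"
      using x by (intro sums_nonneg_imp_has_sum) auto
    moreover have "bij_betw Suc UNIV {1..}"
      by (rule bij_betwI[of _ _ _ "\<lambda>n. n - 1"]) auto
    ultimately show ?thesis
      using has_sum_reindex_bij_betw[of Suc UNIV "{1..}" "\<lambda>k. x ^ (d * k)"] by (simp only: power_mult)
  qed
  have lam: "(\<lambda>(d::nat, k::nat). x ^ (d * k)) summable_on A"
    unfolding A_def
  proof (rule summable_on_SigmaI)
    show "((\<lambda>k. (\<lambda>(d, k). x ^ (d * k)) (d, k)) has_sum (x ^ d / (1 - x ^ d))) {1..}"
      if "d \<in> {1..}" for d using geo[OF that] by simp
    show "(\<lambda>d. x ^ d / (1 - x ^ d)) summable_on {1..}"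
    proof (rule summable_on_comparison_test)
      have "(\<lambda>d. x ^ (1 * d)) summable_on {1..}" using geo[of 1] has_sum_imp_summable by force
      thus "(\<lambda>d. (1 / (1 - x)) * x ^ d) summable_on {1..}" by (intro summable_on_cmult_right) simp
      fix d :: nat assume d: "d \<in> {1..}"
      have "x ^ d \<le> x ^ 1" using x d by (intro power_decreasing) auto
      thus "x ^ d / (1 - x ^ d) \<le> (1 / (1 - x)) * x ^ d"
        using x d xd[of d] by (simp add: frac_le)
      show "0 \<le> x ^ d / (1 - x ^ d)" using x d xd[of d] by simp
    qed
  qed (use x in auto)
  have gA: "g summable_on A"
  proof (rule abs_summable_summable, rule summable_on_comparison_test[OF lam])
    fix p assume "p \<in> A"
    show "norm (g p) \<le> (case p of (d, k) \<Rightarrow> x ^ (d * k))"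
      using f x by (auto simp: g_def abs_mult mult_left_le_one_le split: prod.splits)
  qed auto
  have "((\<lambda>d. f d * (x ^ d / (1 - x ^ d))) has_sum infsum g A) {1..}"
    unfolding A_def
  proof (rule has_sum_SigmaD)
    show "(g has_sum infsum g (SIGMA d:{1..}. {1..})) (SIGMA d:{1..}. {1..})"
      using gA unfolding A_def by (rule has_sum_infsum)
    show "((\<lambda>k. g (d, k)) has_sum f d * (x ^ d / (1 - x ^ d))) {1..}" if "d \<in> {1..}" for d
      unfolding g_def using has_sum_cmult_right[OF geo[OF that], of "f d"] by simp
  qed
  moreover have "bij_betw Suc UNIV {1..}"
    by (rule bij_betwI[of _ _ _ "\<lambda>n. n - 1"]) auto
  ultimately have "((\<lambda>n. f (Suc n) * (x ^ Suc n / (1 - x ^ Suc n))) has_sum infsum g A) UNIV"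
    using has_sum_reindex_bij_betw[of Suc UNIV "{1..}" "\<lambda>d. f d * (x ^ d / (1 - x ^ d))"] by simp
  hence s: "(\<lambda>n. f (Suc n) * (x ^ Suc n / (1 - x ^ Suc n))) sums infsum g A"
    by (rule has_sum_imp_sums)
  show "summable (\<lambda>n. f (Suc n) * (x ^ Suc n / (1 - x ^ Suc n)))" using s by (rule sums_summable)
  have bij: "bij_betw (\<lambda>(m, d). (d, m div d)) B A"
    by (rule bij_betwI[of _ _ _ "\<lambda>(d, k). (d * k, d)"])
       (auto simp: A_def B_def Suc_le_eq dvd_div_eq_0_iff intro!: Nat.gr0I)
  have "(g has_sum infsum g A) A" using gA by (rule has_sum_infsum)
  hence "((\<lambda>p. g ((\<lambda>(m, d). (d, m div d)) p)) has_sum infsum g A) B"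
    using has_sum_reindex_bij_betw[OF bij, of g] by simp
  also have "?this \<longleftrightarrow> ((\<lambda>(m, d). f d * x ^ m) has_sum infsum g A) B"
    by (intro has_sum_cong) (auto simp: B_def g_def)
  finally have "((\<lambda>m. divisor_sum f m * x ^ m) has_sum infsum g A) {1..}"
    unfolding B_def
  proof (rule has_sum_SigmaD)
    fix m :: nat assume "m \<in> {1..}"
    hence "finite {d. d dvd m}" by (intro finite_divisors_nat) auto
    thus "((\<lambda>d. (\<lambda>(m, d). f d * x ^ m) (m, d)) has_sum divisor_sum f m * x ^ m) {d. d dvd m}"
      by (simp add: has_sum_finite_iff divisor_sum_def sum_distrib_right)
  qed
  thus "((\<lambda>m. divisor_sum f m * x ^ m) has_sum (\<Sum>n. f (Suc n) * (x ^ Suc n / (1 - x ^ Suc n)))) {1..}"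
    using sums_unique[OF s] by simp
qed

lemma (in dirichlet_char) nonvanishing_real:
  assumes a: "coprime a N" "chi a \<noteq> 1" and sq: "\<And>n. coprime n N \<Longrightarrow> chi n ^ 2 = 1"
  shows "\<not> (\<lambda>n. chi (Suc n) / of_nat (Suc n)) sums 0"
proof
  assume zero: "(\<lambda>n. chi (Suc n) / of_nat (Suc n)) sums 0"
  define f where "f = (\<lambda>n. Re (chi n))"
  have vals: "chi n \<in> {-1, 0, 1}" for n
    using sq[of n] zero_iff[of n] by (auto simp: power2_eq_1_iff)
  have chi: "chi n = of_real (f n)" for n using vals[of n] by (auto simp: f_def)
  have fv: "f n \<in> {-1, 0, 1}" for n using vals[of n] by (auto simp: f_def)
  have f_mult: "f (m * n) = f m * f n" for m n
    using mult[of m n] unfolding chi by (simp flip: of_real_mult)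
  have f1: "f 1 = 1" by (simp add: f_def)
  have f_le: "\<bar>f n\<bar> \<le> 1" for n using fv[of n] by auto
  have upper: "(\<Sum>m\<in>{1..M}. x ^ m\<^sup>2) \<le> real (N + 1)" if x: "0 < x" "x < 1" for x M
  proof -
    note lam = lambert_series[of x f, OF x f_le]
    define L where "L = (\<Sum>n. f (Suc n) * (x ^ Suc n / (1 - x ^ Suc n)))"
    have nonneg: "divisor_sum f m \<ge> 0" and sq1: "m = k\<^sup>2 \<Longrightarrow> divisor_sum f m \<ge> 1" if "m > 0" for m k
      using divisor_sum_nonneg[of f, OF f_mult f1 fv that] by auto
    have "(\<Sum>m\<in>{1..M}. x ^ m\<^sup>2) = (\<Sum>m\<in>power2 ` {1..M}. x ^ m)"
      by (subst sum.reindex) (auto simp: inj_on_def)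
    also have "\<dots> \<le> (\<Sum>m\<in>power2 ` {1..M}. divisor_sum f m * x ^ m)"
    proof (intro sum_mono)
      fix m assume "m \<in> power2 ` {1..M}"
      then obtain k where "m = k\<^sup>2" "m > 0" by auto
      with sq1[of m k] have "divisor_sum f m \<ge> 1" by auto
      thus "x ^ m \<le> divisor_sum f m * x ^ m" using x by simp
    qed
    also have "\<dots> \<le> L"
    proof (rule has_sum_mono_neutral)
      show "((\<lambda>m. divisor_sum f m * x ^ m) has_sum L) {1..}" using lam(1) by (simp add: L_def)
      show "((\<lambda>m. divisor_sum f m * x ^ m) has_sum (\<Sum>m\<in>power2 ` {1..M}. divisor_sum f m * x ^ m))
             (power2 ` {1..M})" by (rule has_sum_finite) auto
    qed (use nonneg x in auto)
    also have "L \<le> real (N + 1)"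
    proof -
      note ab = abel_summation_bound_antimono[OF partial_sums_bounded[OF a] monsky_weight_tendsto_0[OF x]
          monsky_weight_antimono[OF x]]
      have "(\<lambda>n. (1 / of_real (1 - x)) * (chi (Suc n) / of_nat (Suc n)) -
           of_real (f (Suc n) * (x ^ Suc n / (1 - x ^ Suc n)))) sums
          ((1 / of_real (1 - x)) * 0 - of_real L)"
        unfolding L_def by (intro sums_diff sums_mult zero sums_of_real summable_sums lam(2))
      also have "(\<lambda>n. (1 / of_real (1 - x)) * (chi (Suc n) / of_nat (Suc n)) -
           of_real (f (Suc n) * (x ^ Suc n / (1 - x ^ Suc n)))) =
           (\<lambda>n. chi (Suc n) * of_real (monsky_weight x n))"
        by (auto simp: monsky_weight_def chi algebra_simps)
      finally have "norm (of_real L :: complex) \<le> real (N + 1) * monsky_weight x 0"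
        using ab(2) by (simp add: sums_iff)
      also have "monsky_weight x 0 = 1" using x by (simp add: monsky_weight_def field_simps)
      finally show ?thesis by simp
    qed
    finally show ?thesis .
  qed
  \<comment> \<open>With \<open>N + 2\<close> terms the limit is \<open>N + 2\<close>, just above
    the uniform bound \<open>N + 1\<close>.\<close>
  have lim: "((\<lambda>x::real. \<Sum>m\<in>{1..N + 2}. x ^ m\<^sup>2) \<longlongrightarrow> (\<Sum>m\<in>{1..N + 2}. 1 ^ m\<^sup>2)) (at_left 1)"
    by (intro tendsto_intros)
  have ev: "\<forall>\<^sub>F x::real in at_left 1. 0 < x \<and> x < 1"
    using eventually_at_left_real[of 0 "1::real"] by simp
  have "\<forall>\<^sub>F x in at_left (1::real). (\<Sum>m\<in>{1..N + 2}. x ^ m\<^sup>2) \<le> real (N + 1)"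
    using ev by eventually_elim (rule upper, auto)
  from tendsto_upperbound[OF lim this] show False by simp
qed

theorem (in dirichlet_char) nonvanishing:
  assumes a: "coprime a N" "chi a \<noteq> 1"
  shows "\<not> (\<lambda>n. chi (Suc n) / of_nat (Suc n)) sums 0"
  using nonvanishing_complex nonvanishing_real[OF a] by blast

section \<open>Cotangent sums\<close>

text \<open>Differentiating the reflection formula for the reciprocal Gamma function gives Digamma(1
  - z) - Digamma(z) = \<pi> cot(\<pi> z). In the difference of the two Digamma series the terms 1/(k
  + 1) cancel.\<close>

lemma cot_partial_fractions:
  fixes z :: complex
  assumes z: "z \<notin> \<int>"
  shows "(\<lambda>k. 1 / (z + of_nat k) - 1 / (1 - z + of_nat k)) sums (of_real pi * cot (of_real pi * z))"
proof -
  have z': "z \<notin> \<int>\<^sub>\<le>\<^sub>0" "1 - z \<notin> \<int>\<^sub>\<le>\<^sub>0"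
  proof -
    show "z \<notin> \<int>\<^sub>\<le>\<^sub>0" using z nonpos_Ints_Int by blast
    show "1 - z \<notin> \<int>\<^sub>\<le>\<^sub>0"
    proof
      assume "1 - z \<in> \<int>\<^sub>\<le>\<^sub>0"
      hence "1 - (1 - z) \<in> \<int>" using nonpos_Ints_Int by (intro Ints_diff) auto
      with z show False by simp
    qed
  qed
  have nz: "z \<noteq> 0" "1 - z \<noteq> 0" using z' by auto
  have s: "sin (of_real pi * z) \<noteq> 0"
  proof
    assume "sin (of_real pi * z) = 0"
    then obtain n :: int where "of_real pi * z = of_real (of_int n * pi)"
      by (auto simp: sin_eq_0)
    hence "z = of_int n" by (simp add: mult.commute)
    with z show False by simp
  qed
  have "((\<lambda>w. rGamma w * rGamma (1 - w)) has_field_derivative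
      (rGamma z * rGamma (1 - z) * (Digamma (1 - z) - Digamma z))) (at z)"
    using z' by (auto intro!: derivative_eq_intros simp: algebra_simps)
  moreover have "((\<lambda>w. sin (of_real pi * w) / of_real pi) has_field_derivative cos (of_real pi * z)) (at z)"
    by (auto intro!: derivative_eq_intros)
  ultimately have "rGamma z * rGamma (1 - z) * (Digamma (1 - z) - Digamma z) = cos (of_real pi * z)"
    unfolding rGamma_reflection_complex by (rule DERIV_unique)
  hence "Digamma (1 - z) - Digamma z = of_real pi * cot (of_real pi * z)"
  proof -
    have gen: "x = p * (c / s)" if "s / p * x = c" "s \<noteq> 0" "p \<noteq> 0" for x p c s :: complex
      using that by auto
    have "sin (of_real pi * z) / of_real pi * (Digamma (1 - z) - Digamma z) = cos (of_real pi * z)"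
      using \<open>_ = cos _\<close> by (simp only: rGamma_reflection_complex)
    thus ?thesis unfolding cot_def by (rule gen[OF _ s]) simp
  qed
  moreover have "(\<lambda>k. (inverse (of_nat (Suc k)) - inverse (1 - z + of_nat k)) -
       (inverse (of_nat (Suc k)) - inverse (z + of_nat k))) sums (Digamma (1 - z) - Digamma z)"
    unfolding Digamma_def using sums_diff[OF summable_sums[OF summable_Digamma[OF nz(2)]]
        summable_sums[OF summable_Digamma[OF nz(1)]]] by simp
  ultimately show ?thesis by (simp add: divide_inverse)
qed

lemma sum_reflect:
  fixes f :: "nat \<Rightarrow> 'a :: comm_monoid_add"
  shows "(\<Sum>j=1..<N. f (N - j)) = (\<Sum>j=1..<N. f j)"
  by (rule sum.reindex_bij_witness[of _ "\<lambda>j. N - j" "\<lambda>j. N - j"]) auto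

text \<open>By partial fractions, \<pi> times the cotangent sum is 2 N L(1, \<chi>): the m-th terms
  sum over j to the m-th block of length \<open>N\<close> of the L-series, counted once through j
  and, by oddness, once more through N - j.\<close>

theorem (in dirichlet_char) cot_sum_nonzero:
  assumes odd: "\<And>m n. N dvd m + n \<Longrightarrow> chi m = - chi n"
  shows "(\<Sum>j<N. chi j * cot (of_real (pi * real j / real N))) \<noteq> 0"
proof
  assume zero: "(\<Sum>j<N. chi j * cot (of_real (pi * real j / real N))) = 0"
  have N: "N > 1"
  proof (rule ccontr)
    assume "\<not> N > 1"
    hence "N = 1" using N_pos by simp
    thus False using odd[of 0 0] zero_iff[of 0] by simp
  qed
  have chi_0: "chi 0 = 0" "chi N = 0" using N by (auto simp: zero_iff)
  have "chi (N - 1) = -1" using odd[of "N - 1" 1] N by simp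
  hence nontriv: "chi (N - 1) \<noteq> 1" by simp
  have cop: "coprime (N - 1) N" using N by (intro coprime_diff_one_left_nat) simp
  obtain L where L: "(\<lambda>n. chi (Suc n) / of_nat (Suc n)) sums L"
    using summable_at_1[OF cop nontriv] by (auto simp: summable_def)
  define D where "D = (\<lambda>m. \<Sum>j=1..<N. chi j / of_nat (m * N + j))"
  have "D sums L"
  proof -
    have "(\<Sum>n=m*N..<m*N+N. chi (Suc n) / of_nat (Suc n)) = D m" for m
    proof -
      have "(\<Sum>n=m*N..<m*N+N. chi (Suc n) / of_nat (Suc n)) =
          (\<Sum>j\<in>{1..N}. chi (m * N + j) / of_nat (m * N + j))"
        by (rule sum.reindex_bij_witness[of _ "\<lambda>j. m * N + j - 1" "\<lambda>n. Suc n - m * N"]) auto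
      also have "\<dots> = (\<Sum>j\<in>{1..N}. chi j / of_nat (m * N + j))"
        by (simp add: add.commute[of "m * N"] periodic_mult)
      also have "{1..N} = insert N {1..<N}" using N by auto
      also have "(\<Sum>j\<in>\<dots>. chi j / of_nat (m * N + j)) = D m" using chi_0 by (simp add: D_def)
      finally show ?thesis .
    qed
    \<comment> \<open>Consecutive blocks preserve the order of the terms, so the grouping is
      legitimate although the series need not converge absolutely.\<close>
    thus ?thesis using sums_group[OF L, of N] N by simp
  qed
  moreover have "D sums 0"
  proof -
    define z where "z = (\<lambda>j. of_real (real j / real N) :: complex)"
    have zN: "z j \<notin> \<int>" if "j \<in> {1..<N}" for j
    proof
      assume "z j \<in> \<int>"
      then obtain n :: int where "z j = of_int n" by (auto elim: Ints_cases)
      hence "complex_of_real (real j / real N) = of_real (of_int n)" by (simp add: z_def)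
      hence "real j / real N = of_int n" by (simp only: of_real_eq_iff)
      moreover have "0 < real j / real N" "real j / real N < 1" using that by auto
      ultimately show False by simp
    qed
    have "(\<lambda>m. \<Sum>j=1..<N. chi j * (1 / (z j + of_nat m) - 1 / (1 - z j + of_nat m))) sums
        (\<Sum>j=1..<N. chi j * (of_real pi * cot (of_real pi * z j)))"
      by (intro sums_sum sums_mult cot_partial_fractions zN)
    also have "(\<Sum>j=1..<N. chi j * (of_real pi * cot (of_real pi * z j))) =
        of_real pi * (\<Sum>j=1..<N. chi j * cot (of_real (pi * real j / real N)))"
      by (simp add: sum_distrib_left z_def mult_ac)
    also have "(\<Sum>j=1..<N. chi j * cot (of_real (pi * real j / real N))) =
        (\<Sum>j<N. chi j * cot (of_real (pi * real j / real N)))"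
    proof -
      have "{..<N} = insert 0 {1..<N}" using N by auto
      thus ?thesis using chi_0 by simp
    qed
    also note zero
    also have "(\<lambda>m. \<Sum>j=1..<N. chi j * (1 / (z j + of_nat m) - 1 / (1 - z j + of_nat m))) =
        (\<lambda>m. 2 * of_nat N * D m)"
    proof
      fix m
      have "(\<Sum>j=1..<N. chi j * (1 / (z j + of_nat m) - 1 / (1 - z j + of_nat m))) =
         of_nat N * (\<Sum>j=1..<N. chi j / of_nat (m * N + j) + chi (N - j) / of_nat (m * N + (N - j)))"
        unfolding sum_distrib_left
      proof (rule sum.cong[OF refl])
        fix j assume j: "j \<in> {1..<N}"
        have *: "chi (N - j) = - chi j" using odd[of "N - j" j] j by simp
        have **: "1 / (z j + of_nat m) = of_nat N / of_nat (m * N + j)"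
        proof -
          have "z j + of_nat m = of_nat (m * N + j) / of_nat N"
            using N by (simp add: z_def add_divide_distrib)
          thus ?thesis by simp
        qed
        have ***: "1 / (1 - z j + of_nat m) = of_nat N / of_nat (m * N + (N - j))"
        proof -
          have "1 - z j + of_nat m = of_nat (m * N + (N - j)) / of_nat N"
            using N j by (simp add: z_def of_nat_diff add_divide_distrib diff_divide_distrib)
          thus ?thesis by simp
        qed
        show "chi j * (1 / (z j + of_nat m) - 1 / (1 - z j + of_nat m)) =
          of_nat N * (chi j / of_nat (m * N + j) + chi (N - j) / of_nat (m * N + (N - j)))"
        proof -
          have "c * (n / x - n / y) = n * (c / x + (- c) / y)" for c n x y :: complex
            by (simp add: right_diff_distrib mult.commute)
          thus ?thesis by (simp only: * ** ***)
        qed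
      qed
      also have "\<dots> = 2 * of_nat N * D m"
        using sum_reflect[of "\<lambda>j. chi j / of_nat (m * N + j)" N] by (simp add: sum.distrib D_def)
      finally show "(\<Sum>j=1..<N. chi j * (1 / (z j + of_nat m) - 1 / (1 - z j + of_nat m))) = 2 * of_nat N * D m" .
    qed
    finally have "(\<lambda>m. 2 * of_nat N * D m) sums 0" by simp
    thus ?thesis using N sums_mult_D[of "2 * of_nat N" D 0] by simp
  qed
  ultimately have "L = 0" by (rule sums_unique2)
  with L nonvanishing[OF cop nontriv] show False by simp
qed

section \<open>The space of relations between cotangents and its shifts\<close>

definition cot_kernel :: "nat \<Rightarrow> (nat \<Rightarrow> complex) \<Rightarrow> bool" where
  "cot_kernel N f \<longleftrightarrow> (\<forall>n. f (n mod N) = f n) \<and> (\<forall>n. \<not> coprime n N \<longrightarrow> f n = 0) \<and>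
     (\<forall>m n. N dvd m + n \<longrightarrow> f m = - f n) \<and>
     (\<forall>j. coprime j N \<longrightarrow> (\<Sum>k<N. f k * cot (of_real (pi * real (j * k) / real N))) = 0)"

lemma cot_kernel_sum:
  assumes "\<And>i. i \<in> I \<Longrightarrow> cot_kernel N (f i)"
  shows "cot_kernel N (\<lambda>k. \<Sum>i\<in>I. a i * f i k)"
  unfolding cot_kernel_def
proof (intro conjI allI impI)
  fix n m assume "N dvd m + n"
  thus "(\<Sum>i\<in>I. a i * f i m) = - (\<Sum>i\<in>I. a i * f i n)"
    using assms unfolding sum_negf[symmetric] by (intro sum.cong) (auto simp: cot_kernel_def)
next
  fix n show "(\<Sum>i\<in>I. a i * f i (n mod N)) = (\<Sum>i\<in>I. a i * f i n)"
    using assms by (intro sum.cong) (auto simp: cot_kernel_def)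
next
  fix n assume "\<not> coprime n N"
  thus "(\<Sum>i\<in>I. a i * f i n) = 0"
    using assms by (intro sum.neutral) (auto simp: cot_kernel_def)
next
  fix j assume j: "coprime j N"
  have "(\<Sum>k<N. (\<Sum>i\<in>I. a i * f i k) * cot (of_real (pi * real (j * k) / real N))) =
      (\<Sum>i\<in>I. \<Sum>k<N. a i * (f i k * cot (of_real (pi * real (j * k) / real N))))"
    unfolding sum_distrib_right by (subst sum.swap) (simp only: mult.assoc)
  also have "\<dots> = (\<Sum>i\<in>I. a i * (\<Sum>k<N. f i k * cot (of_real (pi * real (j * k) / real N))))"
    by (simp only: sum_distrib_left)
  also have "\<dots> = 0" using assms j by (intro sum.neutral) (auto simp: cot_kernel_def)
  finally show "(\<Sum>k<N. (\<Sum>i\<in>I. a i * f i k) * cot (of_real (pi * real (j * k) / real N))) = 0" .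
qed

lemma cot_mod:
  assumes "N > 0"
  shows "cot (complex_of_real (pi * real (n mod N) / real N)) = cot (of_real (pi * real n / real N))"
proof -
  have *: "cot (x + pi * real m) = cot x" for x :: real and m
    by (induction m) (simp_all add: distrib_left cot_def sin_add cos_add)
  have "real n = real (n mod N) + real N * real (n div N)"
    by (metis mult_div_mod_eq add.commute of_nat_add of_nat_mult)
  hence "pi * real n / real N = pi * real (n mod N) / real N + pi * real (n div N)"
    using assms by (simp add: field_simps)
  thus ?thesis by (simp only: cot_of_real[symmetric] *)
qed

text \<open>With h inverse to g modulo \<open>N\<close>, substituting k for g k turns the condition
  at j into the condition at j h, which is again coprime to \<open>N\<close>.\<close>

lemma cot_kernel_shift:
  assumes f: "cot_kernel N f" and g: "coprime g N" and N: "N > 0"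
  shows "cot_kernel N (\<lambda>k. f (g * k))"
  unfolding cot_kernel_def
proof (intro conjI allI impI)
  have per: "f (n mod N) = f n" for n using f by (simp add: cot_kernel_def)
  fix n show "f (g * (n mod N)) = f (g * n)"
    using per[of "g * (n mod N)"] per[of "g * n"] by (simp add: mod_mult_right_eq)
next
  fix n assume "\<not> coprime n N"
  thus "f (g * n) = 0" using f by (simp add: cot_kernel_def)
next
  fix m n assume "N dvd m + n"
  hence "N dvd g * m + g * n" by (simp flip: distrib_left)
  thus "f (g * m) = - f (g * n)" using f by (simp add: cot_kernel_def)
next
  fix j assume j: "coprime j N"
  have per: "f (n mod N) = f n" for n using f by (simp add: cot_kernel_def)
  obtain h where h: "[g * h = 1] (mod N)" using cong_solve_coprime_nat[OF g] by auto
  hence "coprime (g * h) N" by (metis cong_imp_coprime cong_sym coprime_1_left)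
  hence "coprime h N" by simp
  define c where "c = (\<lambda>n. cot (complex_of_real (pi * real n / real N)))"
  have c_cong: "c m = c n" if "[m = n] (mod N)" for m n
    using cot_mod[OF N, of m] cot_mod[OF N, of n] that by (simp add: c_def cong_def)
  have "(\<Sum>k<N. f (g * k) * c (j * k)) = (\<Sum>k<N. f ((g * k) mod N) * c (j * h * ((g * k) mod N)))"
  proof (rule sum.cong[OF refl])
    fix k
    have "[j * h * ((g * k) mod N) = j * h * (g * k)] (mod N)"
      by (simp add: cong_def mod_mult_right_eq)
    also have "j * h * (g * k) = (g * h) * (j * k)" by (simp only: mult_ac)
    also have "[(g * h) * (j * k) = 1 * (j * k)] (mod N)" using h by (rule cong_scalar_right)
    finally have "c (j * h * ((g * k) mod N)) = c (j * k)" by (intro c_cong) simp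
    thus "f (g * k) * c (j * k) = f ((g * k) mod N) * c (j * h * ((g * k) mod N))"
      by (simp only: per)
  qed
  also have "\<dots> = (\<Sum>k<N. f k * c (j * h * k))"
    by (rule sum.reindex_bij_betw[OF bij_betw_mult_mod[OF g N]])
  also have "\<dots> = 0"
  proof -
    have "coprime (j * h) N" using j \<open>coprime h N\<close> by simp
    thus ?thesis using f unfolding cot_kernel_def c_def by blast
  qed
  finally show "(\<Sum>k<N. f (g * k) * cot (of_real (pi * real (j * k) / real N))) = 0"
    by (simp only: c_def)
qed

definition scaled_by :: "(nat \<Rightarrow> complex) \<Rightarrow> nat \<Rightarrow> complex \<Rightarrow> bool" where
  "scaled_by f g c \<longleftrightarrow> (\<forall>k. f (g * k) = c * f k)"

lemma root_of_unity_sum: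
  assumes "m > 0" "i < m"
  shows "(\<Sum>l<m. exp (2 * of_real pi * \<i> * of_nat l / of_nat m) ^ i :: complex) =
           (if i = 0 then of_nat m else 0)"
proof (cases "i = 0")
  case False
  define w where "w = (exp (2 * of_real pi * \<i> * of_nat i / of_nat m) :: complex)"
  have "w \<noteq> 1" using complex_root_unity_eq_1[of m i] assms False by (auto simp: w_def dest: dvd_imp_le)
  moreover have "w ^ m = 1" using assms complex_root_unity[of m i] by (simp add: w_def)
  moreover have "exp (2 * of_real pi * \<i> * of_nat l / of_nat m) ^ i = w ^ l" for l
    unfolding w_def exp_of_nat_mult[symmetric] by (rule arg_cong[of _ _ exp]) simp
  ultimately show ?thesis using False by (simp add: sum_gp_strict)
qed auto

text \<open>Averaging over the powers of \<open>g\<close> against a character of the cyclic group it generates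
  projects to an eigenspace of the shift by \<open>g\<close>; some such projection does not kill \<open>f\<close>.\<close>

lemma cot_kernel_eigenvector:
  assumes f: "cot_kernel N f" "f k0 \<noteq> 0" and g: "coprime g N" and N: "N > 0"
  shows "\<exists>f'. cot_kernel N f' \<and> (\<exists>k. f' k \<noteq> 0) \<and> (\<exists>c. scaled_by f' g c) \<and>
              (\<forall>h c. scaled_by f h c \<longrightarrow> scaled_by f' h c)"
proof -
  define m where "m = totient N"
  have m: "m > 0" using N by (simp add: m_def)
  have per: "f (n mod N) = f n" for n using f by (simp add: cot_kernel_def)
  have gm: "f (g ^ m * k) = f k" for k
  proof -
    have "[g ^ m * k = 1 * k] (mod N)" unfolding m_def by (intro cong_scalar_right euler_theorem g)
    thus ?thesis using per[of "g ^ m * k"] per[of k] by (simp add: cong_def)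
  qed
  define w where "w = (\<lambda>l. exp (2 * of_real pi * \<i> * of_nat l / of_nat m) :: complex)"
  define F where "F = (\<lambda>l k. \<Sum>i<m. w l ^ i * f (g ^ i * k))"
  have "(\<Sum>l<m. F l k0) = (\<Sum>i<m. (\<Sum>l<m. w l ^ i) * f (g ^ i * k0))"
    unfolding F_def sum_distrib_right by (rule sum.swap)
  also have "\<dots> = (\<Sum>i<m. if i = 0 then of_nat m * f (g ^ i * k0) else 0)"
    by (intro sum.cong refl) (auto simp: w_def root_of_unity_sum[OF m])
  also have "\<dots> = of_nat m * f k0" using m by (simp add: sum.delta)
  finally have "(\<Sum>l<m. F l k0) \<noteq> 0" using m f by simp
  then obtain l where l: "F l k0 \<noteq> 0" by (meson sum.neutral)
  have wm: "w l ^ m = 1" unfolding w_def using m by (intro complex_root_unity) auto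
  have "scaled_by (F l) g (inverse (w l))"
    unfolding scaled_by_def
  proof
    fix k
    have "w l * F l (g * k) = (\<Sum>i<m. w l ^ Suc i * f (g ^ Suc i * k))"
      by (simp add: F_def sum_distrib_left mult_ac)
    also have "\<dots> = (\<Sum>i<Suc m. w l ^ i * f (g ^ i * k)) - f k"
      by (subst sum.lessThan_Suc_shift) simp
    also have "\<dots> = F l k" by (simp add: F_def wm gm)
    finally show "F l (g * k) = inverse (w l) * F l k" by (simp add: w_def field_simps)
  qed
  moreover have "cot_kernel N (F l)"
    unfolding F_def by (intro cot_kernel_sum cot_kernel_shift f g N) (use g in simp)
  \<comment> \<open>Shifts commute, so the projection keeps every eigenvalue already secured. This
    is what allows the shifts to be treated one after another.\<close>
  moreover have "scaled_by (F l) h c" if "scaled_by f h c" for h c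
  proof -
    have "f (g ^ i * (h * k)) = c * f (g ^ i * k)" for i k
      using that[unfolded scaled_by_def, rule_format, of "g ^ i * k"] by (simp only: mult.left_commute)
    thus ?thesis by (simp add: scaled_by_def F_def sum_distrib_left mult_ac)
  qed
  ultimately show ?thesis using l by blast
qed

lemma cot_kernel_common_eigenvector:
  assumes f: "cot_kernel N f" "f k0 \<noteq> 0" and N: "N > 0"
    and G: "finite G" "\<And>g. g \<in> G \<Longrightarrow> coprime g N"
  shows "\<exists>f'. cot_kernel N f' \<and> (\<exists>k. f' k \<noteq> 0) \<and> (\<forall>g\<in>G. \<exists>c. scaled_by f' g c)"
  using G
proof (induction G rule: finite_induct)
  case empty
  thus ?case using f by auto
next
  case (insert g G)
  then obtain f' k where f': "cot_kernel N f'" "f' k \<noteq> 0" "\<forall>g\<in>G. \<exists>c. scaled_by f' g c" by auto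
  have "coprime g N" using insert by auto
  from cot_kernel_eigenvector[OF f'(1,2) this N] f'(3) show ?case by (metis insert_iff)
qed

text \<open>For a common eigenvector f' with eigenvalues c, evaluation at 1 gives f'(g) = c(g) f'(1)
  on units. Hence f'(1) is nonzero and f'/f'(1) is multiplicative, so it is an odd character; the
  kernel condition at j = 1 then contradicts the nonvanishing of its cotangent sum.\<close>

theorem cot_kernel_trivial:
  assumes f: "cot_kernel N f" and N: "N > 1"
  shows "f k = 0"
proof (rule ccontr)
  assume "f k \<noteq> 0"
  have "\<exists>f'. cot_kernel N f' \<and> (\<exists>k. f' k \<noteq> 0) \<and>
      (\<forall>g\<in>{g. g < N \<and> coprime g N}. \<exists>c. scaled_by f' g c)"
    by (rule cot_kernel_common_eigenvector[OF f \<open>f k \<noteq> 0\<close>]) (use N in simp_all)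
  then obtain f' k' where f': "cot_kernel N f'" "f' k' \<noteq> 0"
    "\<And>g. g < N \<Longrightarrow> coprime g N \<Longrightarrow> \<exists>c. scaled_by f' g c" by blast
  have per: "f' (n mod N) = f' n" for n using f'(1) by (simp add: cot_kernel_def)
  have zero: "f' n = 0" if "\<not> coprime n N" for n using f'(1) that by (simp add: cot_kernel_def)
  have "\<exists>c. \<forall>k. f' (g * k) = c * f' k" if "coprime g N" for g
  proof -
    have "\<exists>c. scaled_by f' (g mod N) c" using f'(3)[of "g mod N"] that N by simp
    then obtain c where c: "scaled_by f' (g mod N) c" ..
    have "f' (g * k) = c * f' k" for k
      using c[unfolded scaled_by_def, rule_format, of k] per[of "g * k"] per[of "(g mod N) * k"]
      by (simp add: mod_mult_left_eq)
    thus ?thesis by blast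
  qed
  then obtain c where c: "\<And>g k. coprime g N \<Longrightarrow> f' (g * k) = c g * f' k" by metis
  have c1: "f' g = c g * f' 1" if "coprime g N" for g using c[OF that, of 1] by simp
  have k': "coprime k' N" using f'(2) zero by blast
  hence f1: "f' 1 \<noteq> 0" using c1[OF k'] f'(2) by (metis mult_zero_right)
  define chi where "chi = (\<lambda>n. f' n / f' 1)"
  interpret dirichlet_char N chi
  proof
    show "N > 0" using N by simp
    show "chi (m * n) = chi m * chi n" for m n
      using c[of m n] c1[of m] f1 zero[of m] zero[of "m * n"]
      by (cases "coprime m N") (auto simp: chi_def)
    show "chi (n + N) = chi n" for n using per[of n] per[of "n + N"] by (simp add: chi_def)
    show "chi n = 0 \<longleftrightarrow> \<not> coprime n N" for n
    proof
      assume "\<not> coprime n N" thus "chi n = 0" using zero by (simp add: chi_def)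
    next
      assume 0: "chi n = 0"
      show "\<not> coprime n N"
      proof
        assume n: "coprime n N"
        obtain h where "[n * h = 1] (mod N)" using cong_solve_coprime_nat[OF n] by auto
        hence "f' (n * h) = f' 1" using per[of "n * h"] per[of 1] by (simp add: cong_def)
        moreover have "f' n = 0" using 0 f1 by (simp add: chi_def)
        hence "c n = 0" using c1[OF n] f1 by simp
        ultimately show False using c[OF n, of h] f1 by simp
      qed
    qed
  qed
  have "chi m = - chi n" if "N dvd m + n" for m n
    using f'(1) that by (simp add: chi_def cot_kernel_def)
  from cot_sum_nonzero[OF this] have "(\<Sum>j<N. chi j * cot (of_real (pi * real j / real N))) \<noteq> 0" .
  moreover have "(\<Sum>j<N. f' j * cot (of_real (pi * real (1 * j) / real N))) = 0"
    using f'(1)[unfolded cot_kernel_def, THEN conjunct2, THEN conjunct2, THEN conjunct2,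
        THEN spec[of _ 1]] by simp
  hence "(\<Sum>j<N. chi j * cot (of_real (pi * real j / real N))) = 0"
    by (simp add: chi_def flip: sum_divide_distrib)
  ultimately show False by simp
qed

section \<open>Roots of unity\<close>

text \<open>The number is an eigenvalue of an integer matrix, hence a root of its characteristic
  polynomial, which is monic with integer coefficients.\<close>

lemma algebraic_int_eigenvalue:
  fixes x :: complex and v :: "nat \<Rightarrow> complex" and A :: "nat \<Rightarrow> nat \<Rightarrow> int"
  assumes eq: "\<And>i. i < n \<Longrightarrow> x * v i = (\<Sum>j<n. of_int (A i j) * v j)"
    and nz: "k < n" "v k \<noteq> 0"
  shows "algebraic_int x"
proof -
  define M where "M = mat n n (\<lambda>(i, j). A i j)"
  define M' where "M' = map_mat (of_int :: int \<Rightarrow> complex) M"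
  have M: "M \<in> carrier_mat n n" "M' \<in> carrier_mat n n" by (auto simp: M_def M'_def)
  have "eigenvector M' (vec n v) x"
    unfolding eigenvector_def
  proof (intro conjI)
    show "vec n v \<in> carrier_vec (dim_row M')" using M by auto
    show "vec n v \<noteq> 0\<^sub>v (dim_row M')"
    proof
      assume "vec n v = 0\<^sub>v (dim_row M')"
      hence "vec n v $ k = 0\<^sub>v (dim_row M') $ k" by simp
      thus False using nz M by simp
    qed
    show "M' *\<^sub>v vec n v = x \<cdot>\<^sub>v vec n v"
      by (rule eq_vecI) (use M in \<open>auto simp: M'_def M_def scalar_prod_def eq lessThan_atLeast0\<close>)
  qed
  hence "eigenvalue M' x" unfolding eigenvalue_def by blast
  hence "poly (char_poly M') x = 0" using eigenvalue_root_char_poly[OF M(2)] by simp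
  hence "poly (of_int_poly (char_poly M)) x = 0"
    unfolding M'_def of_int_hom.char_poly_hom[OF M(1)] .
  moreover have "lead_coeff (char_poly M) = 1" using degree_monic_char_poly[OF M(1)] by simp
  ultimately show ?thesis unfolding algebraic_int_altdef_ipoly by blast
qed

text \<open>The ring \<int>[w] as a set of polynomial values. For a root of unity all its elements
  are shown to be integral at once, so integrality of a number reduces to membership here.\<close>

definition int_adjoin :: "complex \<Rightarrow> complex set" where
  "int_adjoin w = range (\<lambda>p. poly (of_int_poly p) w)"

lemma int_adjoin_of_int [simp]: "of_int n \<in> int_adjoin w"
  unfolding int_adjoin_def by (rule range_eqI[of _ _ "[:n:]"]) (simp add: of_int_hom.map_poly_pCons_hom)

lemma int_adjoin_0 [simp]: "0 \<in> int_adjoin w" and int_adjoin_1 [simp]: "1 \<in> int_adjoin w"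
  using int_adjoin_of_int[of 0 w] int_adjoin_of_int[of 1 w] by simp_all

lemma int_adjoin_of_nat [simp]: "of_nat n \<in> int_adjoin w"
  using int_adjoin_of_int[of "int n" w] by simp

lemma int_adjoin_self [simp]: "w \<in> int_adjoin w"
  unfolding int_adjoin_def by (rule range_eqI[of _ _ "[:0, 1:]"]) simp

lemma int_adjoin_add [intro]: "x \<in> int_adjoin w \<Longrightarrow> y \<in> int_adjoin w \<Longrightarrow> x + y \<in> int_adjoin w"
  unfolding int_adjoin_def by (auto simp: image_iff) (metis of_int_poly_hom.hom_add poly_add)

lemma int_adjoin_mult [intro]: "x \<in> int_adjoin w \<Longrightarrow> y \<in> int_adjoin w \<Longrightarrow> x * y \<in> int_adjoin w"
  unfolding int_adjoin_def by (auto simp: image_iff) (metis of_int_poly_hom.hom_mult poly_mult)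

lemma int_adjoin_minus [intro]: "x \<in> int_adjoin w \<Longrightarrow> - x \<in> int_adjoin w"
  using int_adjoin_mult[of "of_int (-1)" w x] int_adjoin_of_int[of "-1" w] by simp

lemma int_adjoin_diff [intro]: "x \<in> int_adjoin w \<Longrightarrow> y \<in> int_adjoin w \<Longrightarrow> x - y \<in> int_adjoin w"
  using int_adjoin_add[OF _ int_adjoin_minus] by force

lemma int_adjoin_power [intro]: "x \<in> int_adjoin w \<Longrightarrow> x ^ n \<in> int_adjoin w"
  by (induction n) auto

lemma int_adjoin_sum [intro]: "(\<And>i. i \<in> I \<Longrightarrow> f i \<in> int_adjoin w) \<Longrightarrow> sum f I \<in> int_adjoin w"
  by (induction I rule: infinite_finite_induct) auto

lemma int_adjoin_poly:
  assumes "x \<in> int_adjoin w" shows "poly (of_int_poly p) x \<in> int_adjoin w"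
  unfolding poly_altdef by (intro int_adjoin_sum int_adjoin_mult int_adjoin_power) (use assms in simp_all)

text \<open>Reducing exponents modulo n shows that multiplication by a value of p acts on the list
  1, w, ..., w^(n-1) through a matrix of sums of coefficients of p. The powers may be linearly
  dependent.\<close>

lemma poly_eq_sum_mod:
  fixes p :: "'a :: comm_ring_1 poly"
  assumes w: "w ^ n = 1" and n: "n > 0"
  shows "poly p w * w ^ i = (\<Sum>j<n. (\<Sum>m | m \<le> degree p \<and> (m + i) mod n = j. coeff p m) * w ^ j)"
proof -
  have wm: "w ^ m = w ^ (m mod n)" for m
  proof -
    have "w ^ m = w ^ (n * (m div n) + m mod n)" by simp
    thus ?thesis by (simp only: power_add power_mult w power_one mult_1_left)
  qed
  have "(\<Sum>j<n. (\<Sum>m | m \<le> degree p \<and> (m + i) mod n = j. coeff p m) * w ^ j) =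
      (\<Sum>j<n. \<Sum>m | m \<in> {..degree p} \<and> (m + i) mod n = j. coeff p m * w ^ (m + i))"
    unfolding sum_distrib_right by (intro sum.cong refl) (auto simp: wm[of "_ + i"])
  also have "\<dots> = (\<Sum>m\<le>degree p. coeff p m * w ^ (m + i))"
    by (rule sum.group) (use n in auto)
  also have "\<dots> = poly p w * w ^ i"
    by (simp add: poly_altdef sum_distrib_right power_add mult.assoc)
  finally show ?thesis by simp
qed

lemma algebraic_int_int_adjoin_root_of_unity:
  assumes w: "w ^ n = 1" "n > 0" and x: "x \<in> int_adjoin w"
  shows "algebraic_int x"
proof -
  obtain p where p: "x = poly (of_int_poly p) w" using x by (auto simp: int_adjoin_def)
  show ?thesis
  proof (rule algebraic_int_eigenvalue[of n x "\<lambda>i. w ^ i"])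
    fix i assume "i < n"
    show "x * w ^ i = (\<Sum>j<n. of_int (\<Sum>m | m \<le> degree (of_int_poly p :: complex poly) \<and> (m + i) mod n = j. coeff p m) * w ^ j)"
      unfolding p poly_eq_sum_mod[OF w] by simp
  next
    show "0 < n" "w ^ 0 \<noteq> 0" using w by simp_all
  qed
qed

section \<open>Minimal polynomials and the field generated by a root\<close>

definition rat_poly :: "rat poly \<Rightarrow> complex poly" where
  "rat_poly p = map_poly of_rat p"

lemma rat_poly_simps [simp]:
  "rat_poly 0 = 0" "rat_poly 1 = 1" "rat_poly (p + q) = rat_poly p + rat_poly q"
  "rat_poly (p - q) = rat_poly p - rat_poly q" "rat_poly (- p) = - rat_poly p"
  "rat_poly (p * q) = rat_poly p * rat_poly q" "rat_poly (p ^ n) = rat_poly p ^ n"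
  "rat_poly (pCons a p) = pCons (of_rat a) (rat_poly p)"
  "rat_poly (smult a p) = smult (of_rat a) (rat_poly p)"
  "rat_poly (monom a n) = monom (of_rat a) n"
  "coeff (rat_poly p) i = of_rat (coeff p i)" "degree (rat_poly p) = degree p"
  "rat_poly p = 0 \<longleftrightarrow> p = 0"
proof -
  interpret map_poly_inj_idom_hom "of_rat :: rat \<Rightarrow> complex" ..
  show "rat_poly 0 = 0" "rat_poly 1 = 1" "rat_poly (p + q) = rat_poly p + rat_poly q"
  "rat_poly (p - q) = rat_poly p - rat_poly q" "rat_poly (- p) = - rat_poly p"
  "rat_poly (p * q) = rat_poly p * rat_poly q" "rat_poly (p ^ n) = rat_poly p ^ n"
  "rat_poly (pCons a p) = pCons (of_rat a) (rat_poly p)"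
  "rat_poly (smult a p) = smult (of_rat a) (rat_poly p)"
  "rat_poly (monom a n) = monom (of_rat a) n"
  "coeff (rat_poly p) i = of_rat (coeff p i)" "degree (rat_poly p) = degree p"
  "rat_poly p = 0 \<longleftrightarrow> p = 0"
    by (simp_all add: rat_poly_def hom_distribs)
qed

definition is_min_poly :: "rat poly \<Rightarrow> complex \<Rightarrow> bool" where
  "is_min_poly f z \<longleftrightarrow> lead_coeff f = 1 \<and> poly (rat_poly f) z = 0 \<and>
     (\<forall>p. p \<noteq> 0 \<longrightarrow> poly (rat_poly p) z = 0 \<longrightarrow> degree f \<le> degree p)"

lemma min_poly_exists:
  assumes "p \<noteq> 0" "poly (rat_poly p) z = 0"
  obtains f where "is_min_poly f z"
proof -
  define P where "P = (\<lambda>p. p \<noteq> 0 \<and> poly (rat_poly p) z = 0)"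
  have "P p" using assms by (simp add: P_def)
  then obtain g where g: "P g" "\<And>q. P q \<Longrightarrow> degree g \<le> degree q"
    using ex_has_least_nat[of P p degree] by blast
  have "is_min_poly (smult (inverse (lead_coeff g)) g) z"
    using g by (auto simp: is_min_poly_def P_def)
  thus ?thesis by (rule that)
qed

lemma is_min_polyD:
  assumes "is_min_poly f z"
  shows "lead_coeff f = 1" "f \<noteq> 0" "poly (rat_poly f) z = 0"
  using assms by (auto simp: is_min_poly_def)

lemma min_poly_dvd:
  assumes f: "is_min_poly f z" and p: "poly (rat_poly p) z = 0"
  shows "f dvd p"
proof -
  note f' = is_min_polyD[OF f]
  have "rat_poly p = rat_poly f * rat_poly (p div f) + rat_poly (p mod f)"
    by (metis mult_div_mod_eq rat_poly_simps(3,6))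
  hence "poly (rat_poly (p mod f)) z = 0" using p f' by simp
  moreover have "p mod f = 0 \<or> degree (p mod f) < degree f" using f' degree_mod_less by blast
  ultimately have "p mod f = 0" using f by (auto simp: is_min_poly_def not_le[symmetric])
  thus ?thesis by (simp add: mod_eq_0_iff_dvd)
qed

text \<open>Irreducibility in the form used later: every root a of the minimal polynomial f of z
  satisfies no rational equation that z does not. The minimal polynomial g of a divides f; if z were
  not a root of g, it would be a root of the cofactor, whose degree is too small.\<close>

lemma min_poly_conjugate:
  assumes f: "is_min_poly f z" and a: "poly (rat_poly f) a = 0" and p: "poly (rat_poly p) a = 0"
  shows "poly (rat_poly p) z = 0"
proof -
  note f' = is_min_polyD[OF f]
  obtain g where g: "is_min_poly g a" using min_poly_exists[OF f'(2) a] by blast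
  note g' = is_min_polyD[OF g]
  obtain h where h: "f = g * h" using min_poly_dvd[OF g a] by auto
  have "poly (rat_poly g) z = 0"
  proof (rule ccontr)
    assume "poly (rat_poly g) z \<noteq> 0"
    hence "poly (rat_poly h) z = 0" using f'(3) by (simp add: h)
    moreover have "h \<noteq> 0" using h f' by auto
    ultimately have "degree f \<le> degree h" using f by (auto simp: is_min_poly_def)
    hence "degree g = 0" using g' \<open>h \<noteq> 0\<close> by (simp add: h degree_mult_eq)
    then obtain c where "g = [:c:]" by (rule degree_eq_zeroE)
    thus False using g' by simp
  qed
  moreover obtain k where "p = g * k" using min_poly_dvd[OF g p] by auto
  ultimately show ?thesis by simp
qed

definition rat_adjoin :: "complex \<Rightarrow> complex set" where
  "rat_adjoin w = range (\<lambda>p. poly (rat_poly p) w)"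

lemma rat_adjoin_of_rat [simp]: "of_rat c \<in> rat_adjoin w"
  unfolding rat_adjoin_def by (rule range_eqI[of _ _ "[:c:]"]) simp

lemma rat_adjoin_1 [simp]: "1 \<in> rat_adjoin w"
  using rat_adjoin_of_rat[of 1 w] by simp

lemma rat_adjoin_self [simp]: "w \<in> rat_adjoin w"
  unfolding rat_adjoin_def by (rule range_eqI[of _ _ "[:0, 1:]"]) simp

lemma rat_adjoin_add: "x \<in> rat_adjoin w \<Longrightarrow> y \<in> rat_adjoin w \<Longrightarrow> x + y \<in> rat_adjoin w"
  unfolding rat_adjoin_def by (auto simp: image_iff) (metis rat_poly_simps(3) poly_add)

lemma rat_adjoin_minus: "x \<in> rat_adjoin w \<Longrightarrow> - x \<in> rat_adjoin w"
  unfolding rat_adjoin_def by (auto simp: image_iff) (metis rat_poly_simps(5) poly_minus)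

lemma rat_adjoin_mult: "x \<in> rat_adjoin w \<Longrightarrow> y \<in> rat_adjoin w \<Longrightarrow> x * y \<in> rat_adjoin w"
  unfolding rat_adjoin_def by (auto simp: image_iff) (metis rat_poly_simps(6) poly_mult)

lemma rat_adjoin_inverse:
  assumes f: "is_min_poly f w" and x: "x \<in> rat_adjoin w"
  shows "inverse x \<in> rat_adjoin w"
proof (cases "x = 0")
  case True
  thus ?thesis using rat_adjoin_of_rat[of 0 w] by simp
next
  case False
  obtain p where p: "x = poly (rat_poly p) w" using x by (auto simp: rat_adjoin_def)
  define d where "d = gcd p f"
  obtain u v where uv: "u * p + v * f = d" unfolding d_def
    using bezout_coefficients_fst_snd[of p f] by blast
  \<comment> \<open>A complex root of the gcd would be a common root of p and f, which by conjugacy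
    forces p(w) = 0. Without roots the gcd is constant, and the Bezout identity evaluated at w
    supplies the inverse.\<close>
  have "poly (rat_poly d) a \<noteq> 0" for a
  proof
    assume "poly (rat_poly d) a = 0"
    moreover obtain k l where "p = d * k" "f = d * l" unfolding d_def by (metis dvdE gcd_dvd1 gcd_dvd2)
    ultimately have "poly (rat_poly f) a = 0" "poly (rat_poly p) a = 0" by auto
    from min_poly_conjugate[OF f this] show False using False p by simp
  qed
  hence "degree (rat_poly d) = 0"
    using Fundamental_Theorem_Algebra.fundamental_theorem_of_algebra[of "rat_poly d"] by (auto simp: Fundamental_Theorem_Algebra.constant_degree)
  then obtain c where c: "d = [:c:]" by (auto elim: degree_eq_zeroE)
  have "c \<noteq> 0" using \<open>\<And>a. poly (rat_poly d) a \<noteq> 0\<close>[of 0] by (simp add: c)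
  have "poly (rat_poly u) w * x + poly (rat_poly v) w * poly (rat_poly f) w = of_rat c"
    using arg_cong[OF uv, of "\<lambda>q. poly (rat_poly q) w"] by (simp add: p c)
  hence "poly (rat_poly u) w * x = of_rat c" using is_min_polyD[OF f] by simp
  moreover have "of_rat c \<noteq> (0 :: complex)" using \<open>c \<noteq> 0\<close> by simp
  ultimately have "inverse x = inverse (of_rat c) * poly (rat_poly u) w"
    using False by (simp add: divide_simps)
  also have "inverse (of_rat c) = (of_rat (inverse c) :: complex)" by (simp add: of_rat_inverse)
  also have "of_rat (inverse c) * poly (rat_poly u) w \<in> rat_adjoin w"
    by (intro rat_adjoin_mult rat_adjoin_of_rat) (auto simp: rat_adjoin_def)
  finally show ?thesis .
qed

section \<open>Irreducibility of the cyclotomic polynomial\<close>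

definition primitive_root_of_unity :: "nat \<Rightarrow> complex \<Rightarrow> bool" where
  "primitive_root_of_unity n w \<longleftrightarrow> n > 0 \<and> w ^ n = 1 \<and> (\<forall>k. 0 < k \<and> k < n \<longrightarrow> w ^ k \<noteq> 1)"

lemma primitive_root_of_unity_dvd:
  assumes w: "primitive_root_of_unity n w"
  shows "w ^ k = 1 \<longleftrightarrow> n dvd k"
proof -
  have n: "n > 0" "w ^ n = 1" using w by (auto simp: primitive_root_of_unity_def)
  have "w ^ k = w ^ (n * (k div n) + k mod n)" by simp
  hence "w ^ k = w ^ (k mod n)" by (simp only: power_add power_mult n power_one mult_1_left)
  moreover have "w ^ (k mod n) = 1 \<longleftrightarrow> k mod n = 0"
    using w n by (auto simp: primitive_root_of_unity_def)
  ultimately show ?thesis by (simp add: dvd_eq_mod_eq_0)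
qed

lemma primitive_root_of_unity_power:
  assumes w: "primitive_root_of_unity n w" and j: "coprime j n"
  shows "primitive_root_of_unity n (w ^ j)"
  unfolding primitive_root_of_unity_def
proof (intro conjI allI impI)
  show n: "n > 0" using w by (simp add: primitive_root_of_unity_def)
  show "(w ^ j) ^ n = 1" by (simp add: primitive_root_of_unity_dvd[OF w] flip: power_mult)
  fix k assume k: "0 < k \<and> k < n"
  have "\<not> n dvd j * k"
    using k j coprime_dvd_mult_right_iff[of n j k] by (auto simp: coprime_commute dest: dvd_imp_le)
  thus "(w ^ j) ^ k \<noteq> 1" by (simp add: primitive_root_of_unity_dvd[OF w] flip: power_mult)
qed

lemma primitive_root_of_unity_inj:
  assumes w: "primitive_root_of_unity n w" and ij: "i < n" "j < n" "w ^ i = w ^ j"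
  shows "i = j"
proof -
  have w0: "w \<noteq> 0" using w by (auto simp: primitive_root_of_unity_def power_0_left)
  have *: "b = a" if "w ^ a = w ^ b" "a \<le> b" "b < n" for a b
  proof -
    have "w ^ b = w ^ a * w ^ (b - a)" using that(2) by (metis le_add_diff_inverse power_add)
    hence "w ^ a * w ^ (b - a) = w ^ a * 1" using that(1) by (simp only: mult_1_right)
    hence "w ^ (b - a) = 1" using w0 by (subst (asm) mult_left_cancel) simp_all
    hence "n dvd b - a" by (simp add: primitive_root_of_unity_dvd[OF w])
    thus ?thesis using that by (auto dest: dvd_imp_le)
  qed
  show ?thesis
  proof (cases "i \<le> j")
    case True
    show ?thesis using *[OF ij(3) True ij(2)] by simp
  next
    case False
    thus ?thesis using *[OF ij(3)[symmetric] _ ij(1)] by simp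
  qed
qed

lemma roots_of_unity_eq_powers:
  assumes w: "primitive_root_of_unity n w" and a: "a ^ n = 1"
  shows "\<exists>k<n. a = w ^ k"
proof -
  have n: "n > 0" "w ^ n = 1" using w by (auto simp: primitive_root_of_unity_def)
  have "inj_on (\<lambda>k. w ^ k) {..<n}" using primitive_root_of_unity_inj[OF w] by (auto simp: inj_on_def)
  hence "card ((\<lambda>k. w ^ k) ` {..<n}) = n" by (simp add: card_image)
  moreover have "(\<lambda>k. w ^ k) ` {..<n} \<subseteq> {z. z ^ n = 1}"
    using primitive_root_of_unity_dvd[OF w] by (auto simp flip: power_mult)
  moreover have "card {z::complex. z ^ n = 1} = n" "finite {z::complex. z ^ n = 1}"
    using n card_complex_roots_unity finite_roots_unity[of n] by auto
  ultimately have "(\<lambda>k. w ^ k) ` {..<n} = {z. z ^ n = 1}" by (intro card_subset_eq) auto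
  thus ?thesis using a by auto
qed

lemma coeff_prod_linear_int_adjoin:
  assumes "\<And>a. a \<in> set as \<Longrightarrow> a \<in> int_adjoin w"
  shows "coeff (\<Prod>a\<leftarrow>as. [:- a, 1:]) i \<in> int_adjoin w"
  using assms
proof (induction as arbitrary: i)
  case Nil
  thus ?case by (cases i) simp_all
next
  case (Cons a as)
  have "coeff (\<Prod>a\<leftarrow>a # as. [:- a, 1:]) i =
      - a * coeff (\<Prod>a\<leftarrow>as. [:- a, 1:]) i + (case i of 0 \<Rightarrow> 0 | Suc k \<Rightarrow> coeff (\<Prod>a\<leftarrow>as. [:- a, 1:]) k)"
    by (simp add: coeff_pCons)
  also have "\<dots> \<in> int_adjoin w"
    using Cons by (intro int_adjoin_add int_adjoin_mult int_adjoin_minus) (auto split: nat.splits)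
  finally show ?case .
qed

definition unity_poly :: "nat \<Rightarrow> rat poly" where
  "unity_poly n = monom 1 n - 1"

lemma poly_unity_poly: "poly (rat_poly (unity_poly n)) z = z ^ n - 1"
  by (simp add: unity_poly_def poly_monom)

text \<open>This plays the role of the Gauss lemma. The roots of g are powers of w, so its
  coefficients are polynomial expressions in them and lie in \<int>[w]; being rational and integral,
  they are integers.\<close>

lemma monic_divisor_unity_poly_int:
  assumes w: "primitive_root_of_unity n w" and g: "lead_coeff g = 1" "g dvd unity_poly n"
  obtains h :: "int poly" where "rat_poly g = of_int_poly h"
proof -
  obtain as where as: "smult (lead_coeff (rat_poly g)) (\<Prod>a\<leftarrow>as. [:- a, 1:]) = rat_poly g"
    using fundamental_theorem_algebra_factorized[of "rat_poly g"] by blast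
  hence as': "rat_poly g = (\<Prod>a\<leftarrow>as. [:- a, 1:])" using g by simp
  obtain k where k: "unity_poly n = g * k" using g by auto
  have "a \<in> int_adjoin w" if "a \<in> set as" for a
  proof -
    have "poly (rat_poly g) a = 0"
      unfolding as' poly_prod_list prod_list_zero_iff using that by (auto simp: image_iff intro!: bexI[of _ a])
    hence "poly (rat_poly (unity_poly n)) a = 0" by (simp add: k)
    hence "a ^ n = 1" by (simp add: poly_unity_poly)
    then obtain j where "a = w ^ j" using roots_of_unity_eq_powers[OF w] by auto
    thus ?thesis by (auto intro: int_adjoin_power)
  qed
  hence "coeff (rat_poly g) i \<in> int_adjoin w" for i
    unfolding as' by (rule coeff_prod_linear_int_adjoin)
  hence "algebraic_int (of_rat (coeff g i) :: complex)" for i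
    using w algebraic_int_int_adjoin_root_of_unity[of w n]
    by (auto simp: primitive_root_of_unity_def)
  hence "of_rat (coeff g i) \<in> (\<int> :: complex set)" for i
    by (rule rational_algebraic_int_is_int) simp
  hence "\<exists>m :: int. of_rat (coeff g i) = (of_int m :: complex)" for i by (auto elim: Ints_cases)
  then obtain c where c: "\<And>i. of_rat (coeff g i) = (of_int (c i) :: complex)" by metis
  define h where "h = Poly (map c [0..<Suc (degree g)])"
  have "rat_poly g = of_int_poly h"
  proof (rule poly_eqI)
    fix i
    show "coeff (rat_poly g) i = coeff (of_int_poly h) i"
    proof (cases "i \<le> degree g")
      case True
      thus ?thesis by (simp add: h_def c nth_default_def del: upt_Suc)
    next
      case False
      thus ?thesis by (simp add: h_def coeff_eq_0 nth_default_def del: upt_Suc)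
    qed
  qed
  thus ?thesis by (rule that)
qed

lemma binomial_prime_power_int_adjoin:
  assumes q: "prime q" and xy: "x \<in> int_adjoin w" "y \<in> int_adjoin w"
  obtains s where "s \<in> int_adjoin w" "(x + y) ^ q = x ^ q + y ^ q + of_nat q * s"
proof -
  define s where "s = (\<Sum>k\<in>{1..<q}. of_nat ((q choose k) div q) * x ^ k * y ^ (q - k))"
  have q0: "q > 0" using q prime_gt_0_nat by blast
  have "{..q} = insert 0 (insert q {1..<q})" using q0 by auto
  hence "(x + y) ^ q = x ^ q + y ^ q + (\<Sum>k\<in>{1..<q}. of_nat (q choose k) * x ^ k * y ^ (q - k))"
    using q0 by (simp add: binomial_ring add_ac)
  also have "(\<Sum>k\<in>{1..<q}. of_nat (q choose k) * x ^ k * y ^ (q - k)) = of_nat q * s"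
    unfolding s_def sum_distrib_left
  proof (rule sum.cong[OF refl])
    fix k assume "k \<in> {1..<q}"
    hence "q dvd q choose k" using q by (intro dvd_choose_prime) auto
    hence "q choose k = q * ((q choose k) div q)" by simp
    hence "(of_nat (q choose k) :: complex) = of_nat q * of_nat ((q choose k) div q)"
      by (metis of_nat_mult)
    thus "of_nat (q choose k) * x ^ k * y ^ (q - k) =
        of_nat q * (of_nat ((q choose k) div q) * x ^ k * y ^ (q - k))" by (simp only: mult_ac)
  qed
  finally have "(x + y) ^ q = x ^ q + y ^ q + of_nat q * s" .
  moreover have "s \<in> int_adjoin w"
    unfolding s_def by (intro int_adjoin_sum int_adjoin_mult int_adjoin_power int_adjoin_of_nat xy)
  ultimately show ?thesis using that by blast
qed

lemma int_fermat_little: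
  fixes a :: int assumes q: "prime q"
  shows "int q dvd a ^ q - a"
proof (cases "int q dvd a")
  case True
  have "q > 0" using q prime_gt_0_nat by blast
  thus ?thesis using True by (intro dvd_diff) (auto intro: dvd_power_same dvd_trans dvd_power)
next
  case False
  define b where "b = nat (a mod int q)"
  have q0: "q > 0" using q prime_gt_0_nat by blast
  have b: "[a = int b] (mod int q)" using q0 by (simp add: b_def cong_def)
  have "\<not> q dvd b"
    using False b by (metis cong_dvd_iff int_dvd_int_iff)
  hence "[b ^ (q - 1) = 1] (mod q)" using q by (intro fermat_theorem)
  hence "[b ^ (q - 1) * b = 1 * b] (mod q)" by (rule cong_scalar_right)
  hence "[b ^ q = b] (mod q)" using q0 by (simp add: power_eq_if mult.commute)
  hence "[int b ^ q = int b] (mod int q)" by (metis cong_int_iff of_nat_power)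
  hence "[a ^ q = a] (mod int q)" using b by (meson cong_pow cong_sym cong_trans)
  thus ?thesis by (simp add: cong_iff_dvd_diff)
qed

text \<open>The congruence P(w^q) = P(w)^q modulo q \<int>[w]. It follows along the Horner scheme,
  from the binomial theorem for the sum and Fermat's little theorem for the coefficient.\<close>

lemma frobenius_int_poly:
  assumes q: "prime q"
  obtains s where "s \<in> int_adjoin w"
    "poly (of_int_poly p) (w ^ q) = poly (of_int_poly p) w ^ q + of_nat q * s"
proof (induction p arbitrary: thesis)
  case 0
  have "q > 0" using q prime_gt_0_nat by blast
  thus ?case using 0[of 0] by simp
next
  case (pCons a p)
  let ?P = "poly (of_int_poly p)"
  obtain s where s: "s \<in> int_adjoin w" "?P (w ^ q) = ?P w ^ q + of_nat q * s"
    using pCons.IH by blast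
  have "w * ?P w \<in> int_adjoin w" by (intro int_adjoin_mult int_adjoin_self int_adjoin_poly)
  then obtain t where t: "t \<in> int_adjoin w"
    "(of_int a + w * ?P w) ^ q = of_int a ^ q + (w * ?P w) ^ q + of_nat q * t"
    using binomial_prime_power_int_adjoin[OF q int_adjoin_of_int] by blast
  obtain c where c: "a ^ q - a = int q * c" using int_fermat_little[OF q] by auto
  have "(of_int (a ^ q - a) :: complex) = of_int (int q * c)" by (simp only: c)
  hence c': "of_int a = of_int a ^ q - of_nat q * (of_int c :: complex)" by (simp add: algebra_simps)
  have ev: "poly (of_int_poly (pCons a p)) z = of_int a + z * ?P z" for z :: complex
    by (simp add: of_int_hom.map_poly_pCons_hom)
  have "poly (of_int_poly (pCons a p)) (w ^ q) = of_int a + w ^ q * (?P w ^ q + of_nat q * s)"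
    by (simp only: ev s)
  also have "\<dots> = of_int a ^ q - of_nat q * of_int c + (w * ?P w) ^ q + of_nat q * (w ^ q * s)"
    by (subst c') (simp add: algebra_simps power_mult_distrib)
  also have "\<dots> = (of_int a + w * ?P w) ^ q + of_nat q * (w ^ q * s - of_int c - t)"
    unfolding t(2) by (simp add: algebra_simps)
  finally have "poly (of_int_poly (pCons a p)) (w ^ q) = poly (of_int_poly (pCons a p)) w ^ q
      + of_nat q * (w ^ q * s - of_int c - t)" by (simp only: ev)
  moreover have "w ^ q * s - of_int c - t \<in> int_adjoin w"
    by (intro int_adjoin_diff int_adjoin_mult int_adjoin_power int_adjoin_self int_adjoin_of_int s t)
  ultimately show ?case using pCons.prems by blast
qed

text \<open>Writing \<open>X^n - 1 = F G\<close>, a value \<open>F(w^q) \<noteq> 0\<close> would divide \<open>n\<close> (evaluate the derivative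
  at \<open>w^q\<close>), but it is also divisible by \<open>q\<close>, since \<open>F(w^q)\<close> is congruent to \<open>F(w)^q = 0\<close>.\<close>

lemma min_poly_root_of_unity_prime_power:
  assumes w: "primitive_root_of_unity n w" and f: "is_min_poly f w"
    and q: "prime q" "\<not> q dvd n"
  shows "poly (rat_poly f) (w ^ q) = 0"
proof (rule ccontr)
  assume nz: "poly (rat_poly f) (w ^ q) \<noteq> 0"
  have n: "n > 0" "w ^ n = 1" using w by (auto simp: primitive_root_of_unity_def)
  note f' = is_min_polyD[OF f]
  have "f dvd unity_poly n" using n by (intro min_poly_dvd[OF f]) (simp add: poly_unity_poly)
  then obtain g where g: "unity_poly n = f * g" by auto
  have "lead_coeff (unity_poly n) = 1"
  proof -
    have "degree (monom 1 n + (-1) :: rat poly) = n"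
      using n by (subst degree_add_eq_left) (simp_all add: degree_monom_eq)
    thus ?thesis using n by (simp add: unity_poly_def)
  qed
  hence lg: "lead_coeff g = 1" using f' by (simp add: g lead_coeff_mult)
  obtain F where F: "rat_poly f = of_int_poly F"
    using monic_divisor_unity_poly_int[OF w f'(1)] g by auto
  obtain G where G: "rat_poly g = of_int_poly G"
    using monic_divisor_unity_poly_int[OF w lg] g by auto
  define u where "u = w ^ q"
  have u: "u ^ n = 1" unfolding u_def using n by (metis mult.commute power_mult power_one)
  have uw: "u \<in> int_adjoin w" unfolding u_def by (intro int_adjoin_power int_adjoin_self)
  have eq: "monom 1 n - 1 = of_int_poly F * (of_int_poly G :: complex poly)"
    using arg_cong[OF g, of rat_poly] by (simp add: unity_poly_def F G)
  have "poly (of_int_poly F) u * poly (of_int_poly G) u = u ^ n - 1"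
    using arg_cong[OF eq, of "\<lambda>p. poly p u"] by (simp add: poly_monom)
  hence G0: "poly (of_int_poly G) u = 0" using nz[folded u_def] u by (simp add: F)
  have "of_nat n * u ^ (n - 1) = poly (of_int_poly F) u * poly (pderiv (of_int_poly G)) u"
    using arg_cong[OF eq, of "\<lambda>p. poly (pderiv p) u"] G0
    by (simp add: pderiv_diff pderiv_monom poly_monom pderiv_mult)
  hence "of_nat n * (u ^ (n - 1) * u) = poly (of_int_poly F) u * poly (pderiv (of_int_poly G)) u * u"
    by (simp only: mult.assoc[symmetric])
  moreover have "u ^ (n - 1) * u = 1" using u n by (metis power_minus_mult)
  ultimately have nF: "of_nat n = poly (of_int_poly F) u * (poly (of_int_poly (pderiv G)) u * u)"
    by (simp only: of_int_hom.map_poly_pderiv mult.assoc mult_1_right)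
  obtain s where s: "s \<in> int_adjoin w"
    "poly (of_int_poly F) (w ^ q) = poly (of_int_poly F) w ^ q + of_nat q * s"
    using frobenius_int_poly[OF q(1)] by blast
  have q0: "q > 0" using q prime_gt_0_nat by blast
  have "poly (of_int_poly F) u = of_nat q * s" using s(2) f'(3) q0 by (simp add: F u_def)
  hence "of_nat n = of_nat q * (s * (poly (of_int_poly (pderiv G)) u * u))"
    using nF by (simp add: mult.assoc)
  \<comment> \<open>Thus n/q is a rational element of \<int>[w], hence an integer, against the
    choice of q.\<close>
  hence r: "of_rat (of_nat n / of_nat q) = s * (poly (of_int_poly (pderiv G)) u * u)"
    using q0 by (simp add: of_rat_divide field_simps)
  have "s * (poly (of_int_poly (pderiv G)) u * u) \<in> int_adjoin w"
    by (intro int_adjoin_mult int_adjoin_poly s uw)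
  hence "algebraic_int (of_rat (of_nat n / of_nat q) :: complex)"
    unfolding r by (rule algebraic_int_int_adjoin_root_of_unity[OF n(2,1)])
  hence "(of_rat (of_nat n / of_nat q) :: complex) \<in> \<int>"
    by (rule rational_algebraic_int_is_int) simp
  then obtain m :: int where "(of_rat (of_nat n / of_nat q) :: complex) = of_int m"
    by (auto elim: Ints_cases)
  hence "(of_nat n :: complex) = of_int m * of_nat q" using q0 by (simp add: of_rat_divide field_simps)
  hence "(of_int (int n) :: complex) = of_int (m * int q)" by simp
  hence "int n = m * int q" by (simp only: of_int_eq_iff)
  hence "q dvd n" by (metis dvd_triv_right int_dvd_int_iff)
  with q show False by simp
qed

text \<open>One prime factor q of j is removed at a time, passing from w to w^q. Since j is coprime
  to n, so is q, and w^q is again primitive; hence w must stay arbitrary in the induction.\<close>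

theorem galois_conjugate_root_of_unity:
  assumes "primitive_root_of_unity n w" "coprime j n" "poly (rat_poly p) w = 0"
  shows "poly (rat_poly p) (w ^ j) = 0"
  using assms
proof (induction j arbitrary: w rule: less_induct)
  case (less j)
  show ?case
  proof (cases "j \<le> 1")
    case True
    \<comment> \<open>The exponent 0 is coprime to n only for n = 1, where w = 1.\<close>
    hence "w ^ j = w"
    proof (cases "j = 0")
      case True
      hence "n = 1" using less.prems by simp
      thus ?thesis using less.prems by (simp add: primitive_root_of_unity_def True)
    next
      case False
      hence "j = 1" using \<open>j \<le> 1\<close> by simp
      thus ?thesis by simp
    qed
    thus ?thesis using less.prems by simp
  next
    case False
    then obtain q where q: "prime q" "q dvd j" using prime_factor_nat[of j] by auto
    then obtain k where k: "j = q * k" by auto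
    have cop: "coprime q n" "coprime k n" using less.prems(2) by (auto simp: k)
    have q1: "q > 1" using q prime_gt_1_nat by blast
    have "k > 0" using False k by (auto intro!: Nat.gr0I)
    hence "k < j" using q1 by (simp add: k)
    have nq: "\<not> q dvd n" using coprime_common_divisor[OF cop(1), of q] q1 by auto
    have "n > 0" "w ^ n = 1" using less.prems by (auto simp: primitive_root_of_unity_def)
    hence "unity_poly n \<noteq> 0" "poly (rat_poly (unity_poly n)) w = 0"
      by (auto simp: unity_poly_def poly_unity_poly poly_eq_iff poly_monom dest: spec[of _ 0])
    then obtain f where f: "is_min_poly f w" using min_poly_exists by blast
    have "poly (rat_poly f) (w ^ q) = 0"
      by (rule min_poly_root_of_unity_prime_power[OF less.prems(1) f q(1) nq])
    moreover obtain h where "p = f * h" using min_poly_dvd[OF f less.prems(3)] by auto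
    ultimately have "poly (rat_poly p) (w ^ q) = 0" by simp
    from less.IH[OF \<open>k < j\<close> primitive_root_of_unity_power[OF less.prems(1) cop(1)] cop(2) this]
    show ?thesis by (simp add: k power_mult)
  qed
qed

text \<open>The minimal polynomial divides X^n - 1, whose derivative vanishes only at 0, so its
  degree is its number of roots. A root w^k with k not coprime to n would have order dividing some m
  < n, and by conjugacy w^m = 1.\<close>

lemma min_poly_root_of_unity_degree:
  assumes w: "primitive_root_of_unity n w" and f: "is_min_poly f w"
  shows "degree f \<le> card {k. k < n \<and> coprime k n}"
proof -
  have n: "n > 0" "w ^ n = 1" using w by (auto simp: primitive_root_of_unity_def)
  note f' = is_min_polyD[OF f]
  have "f dvd unity_poly n" using n by (intro min_poly_dvd[OF f]) (simp add: poly_unity_poly)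
  then obtain g where g: "unity_poly n = f * g" by auto
  have root: "a ^ n = 1" if "poly (rat_poly f) a = 0" for a
  proof -
    have "poly (rat_poly (unity_poly n)) a = 0" using that by (simp add: g)
    thus ?thesis by (simp add: poly_unity_poly)
  qed
  have "rsquarefree (rat_poly f)"
    unfolding rsquarefree_roots
  proof (intro allI notI)
    fix a assume a: "poly (rat_poly f) a = 0 \<and> poly (pderiv (rat_poly f)) a = 0"
    have "monom 1 n - 1 = rat_poly f * rat_poly g"
      using arg_cong[OF g, of rat_poly] by (simp add: unity_poly_def)
    from arg_cong[OF this, of "\<lambda>p. poly (pderiv p) a"] a
    have "of_nat n * a ^ (n - 1) = 0"
      by (simp add: pderiv_diff pderiv_monom poly_monom pderiv_mult)
    hence "a = 0" using n by simp
    thus False using root[of a] a n by (simp add: power_0_left)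
  qed
  hence "degree f = card {a. poly (rat_poly f) a = 0}"
    using rsquarefree_card_degree[of "rat_poly f"] f' by simp
  also have "{a. poly (rat_poly f) a = 0} \<subseteq> (\<lambda>k. w ^ k) ` {k. k < n \<and> coprime k n}"
  proof
    fix a assume "a \<in> {a. poly (rat_poly f) a = 0}"
    hence a: "poly (rat_poly f) a = 0" by simp
    obtain k where k: "k < n" "a = w ^ k" using roots_of_unity_eq_powers[OF w root[OF a]] by auto
    have "coprime k n"
    proof (rule ccontr)
      assume nc: "\<not> coprime k n"
      define d where "d = gcd k n"
      have d: "d dvd k" "d dvd n" by (auto simp: d_def)
      have "d \<noteq> 0" using n by (simp add: d_def)
      have "d \<noteq> 1" using nc unfolding d_def by (metis coprime_iff_gcd_eq_1)
      then obtain k' m where km: "k = d * k'" "n = d * m" using d by (elim dvdE)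
      have m: "m < n" "m > 0" using km n \<open>d \<noteq> 0\<close> \<open>d \<noteq> 1\<close> by (auto intro!: Nat.gr0I)
      have "a ^ m = w ^ (n * k')" unfolding k km by (simp add: mult_ac flip: power_mult)
      also have "\<dots> = 1" using n by (simp add: power_mult)
      finally have "poly (rat_poly (unity_poly m)) a = 0" by (simp add: poly_unity_poly)
      hence "poly (rat_poly (unity_poly m)) w = 0" by (rule min_poly_conjugate[OF f a])
      hence "w ^ m = 1" by (simp add: poly_unity_poly)
      with w m show False by (auto simp: primitive_root_of_unity_def)
    qed
    thus "a \<in> (\<lambda>k. w ^ k) ` {k. k < n \<and> coprime k n}" using k by auto
  qed
  hence "card {a. poly (rat_poly f) a = 0} \<le> card ((\<lambda>k. w ^ k) ` {k. k < n \<and> coprime k n})"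
    by (intro card_mono) auto
  also have "\<dots> \<le> card {k. k < n \<and> coprime k n}" by (intro card_image_le) auto
  finally show ?thesis .
qed

section \<open>Dimension bounds over the rationals\<close>

lemma rat_adjoin_span:
  assumes f: "is_min_poly f w"
  shows "rat_adjoin w \<subseteq> rat_vs.span ((\<lambda>i. w ^ i) ` {..<degree f})"
proof
  fix x assume "x \<in> rat_adjoin w"
  then obtain p where p: "x = poly (rat_poly p) w" by (auto simp: rat_adjoin_def)
  note f' = is_min_polyD[OF f]
  define r where "r = p mod f"
  have "rat_poly p = rat_poly f * rat_poly (p div f) + rat_poly r"
    unfolding r_def by (metis mult_div_mod_eq rat_poly_simps(3,6))
  hence "x = poly (rat_poly r) w" using f' p by simp
  also have "\<dots> = (\<Sum>i\<le>degree r. rat_scale (coeff r i) (w ^ i))"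
    by (simp add: poly_altdef rat_scale_def)
  also have "\<dots> \<in> rat_vs.span ((\<lambda>i. w ^ i) ` {..<degree f})"
  proof (intro rat_vs.span_sum)
    fix i assume i: "i \<in> {..degree r}"
    show "rat_scale (coeff r i) (w ^ i) \<in> rat_vs.span ((\<lambda>i. w ^ i) ` {..<degree f})"
    proof (cases "r = 0")
      case True
      thus ?thesis by (simp add: rat_scale_def rat_vs.span_zero)
    next
      case False
      hence "degree r < degree f" using f' degree_mod_less[of f p] by (auto simp: r_def)
      thus ?thesis using i by (intro rat_vs.span_scale rat_vs.span_base) auto
    qed
  qed
  finally show "x \<in> rat_vs.span ((\<lambda>i. w ^ i) ` {..<degree f})" .
qed

lemma cnj_of_rat [simp]: "cnj (of_rat q) = of_rat q"
  by (cases q) (simp add: of_rat_rat)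

text \<open>Multiplication by a purely imaginary \<open>t\<close> moves an independent set of real numbers to
  one that is independent of it, so such a set fills at most half of the dimension.\<close>

lemma card_independent_reals:
  assumes T: "finite T" and B: "rat_vs.independent B" "B \<subseteq> \<real>" "B \<subseteq> rat_vs.span T"
    and t: "t \<noteq> 0" "cnj t = - t" "\<And>b. b \<in> B \<Longrightarrow> t * b \<in> rat_vs.span T"
  shows "finite B \<and> 2 * card B \<le> card T"
proof -
  have fB: "finite B" using rat_vs.independent_span_bound[OF T B(1) B(3)] by simp
  have real: "cnj b = b" if "b \<in> B" for b using B(2) that by (auto simp: Reals_cnj_iff)
  have b0: "b \<noteq> 0" if "b \<in> B" for b using B(1) that rat_vs.dependent_zero by blast
  have inj: "inj_on ((*) t) B" using t by (auto simp: inj_on_def)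
  have disj: "B \<inter> (*) t ` B = {}"
  proof (rule ccontr)
    assume "B \<inter> (*) t ` B \<noteq> {}"
    then obtain b c where bc: "b \<in> B" "c \<in> B" "b = t * c" by auto
    hence "cnj b = - b" using real[of c] t by simp
    hence "b = 0" using real[OF bc(1)] by simp
    thus False using b0[OF bc(1)] by simp
  qed
  have "rat_vs.independent (B \<union> (*) t ` B)"
    unfolding rat_vs.independent_explicit_finite_subsets
  proof (intro allI impI)
    fix S u assume S: "S \<subseteq> B \<union> (*) t ` B" "finite S" and sum: "(\<Sum>v\<in>S. rat_scale (u v) v) = 0"
    define S1 where "S1 = S \<inter> B"
    define S2 where "S2 = {b \<in> B. t * b \<in> S}"
    define x where "x = (\<Sum>v\<in>S1. rat_scale (u v) v)"
    define y where "y = (\<Sum>v\<in>S2. rat_scale (u (t * v)) v)"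
    have fin: "finite S1" "finite S2" using S fB by (auto simp: S1_def S2_def)
    have "S = S1 \<union> (*) t ` S2" using S by (auto simp: S1_def S2_def)
    moreover have "S1 \<inter> (*) t ` S2 = {}" using disj by (auto simp: S1_def S2_def)
    ultimately have "(\<Sum>v\<in>S. rat_scale (u v) v) = x + (\<Sum>v\<in>(*) t ` S2. rat_scale (u v) v)"
      using fin by (simp add: sum.union_disjoint x_def)
    also have "(\<Sum>v\<in>(*) t ` S2. rat_scale (u v) v) = t * y"
      using inj by (subst sum.reindex) (auto simp: S2_def y_def rat_scale_def sum_distrib_left
          inj_on_def mult_ac)
    finally have xy: "x + t * y = 0" using sum by simp
    \<comment> \<open>Conjugating x + t y = 0 negates only the second summand, so the relation
      splits into two relations inside the given independent set.\<close>
    have cx: "cnj x = x" "cnj y = y"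
      unfolding x_def y_def cnj_sum rat_scale_def complex_cnj_mult
      using real by (auto intro!: sum.cong simp: S1_def S2_def)
    have "x - t * y = 0" using arg_cong[OF xy, of cnj] by (simp add: cx t)
    hence "x = 0" "t * y = 0" using xy by auto
    hence x0: "x = 0" "y = 0" using t by auto
    have "\<forall>v\<in>S1. u v = 0"
      using B(1)[unfolded rat_vs.independent_explicit_finite_subsets, rule_format, of S1 u]
        fin x0 by (auto simp: x_def S1_def)
    moreover have "\<forall>v\<in>S2. u (t * v) = 0"
      using B(1)[unfolded rat_vs.independent_explicit_finite_subsets, rule_format, of S2 "\<lambda>v. u (t * v)"]
        fin x0 by (auto simp: y_def S2_def)
    ultimately show "\<forall>v\<in>S. u v = 0" using \<open>S = S1 \<union> (*) t ` S2\<close> by auto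
  qed
  moreover have "B \<union> (*) t ` B \<subseteq> rat_vs.span T" using B t by auto
  ultimately have "card (B \<union> (*) t ` B) \<le> card T"
    using rat_vs.independent_span_bound[OF T] by blast
  thus ?thesis using fB inj disj by (simp add: card_Un_disjoint card_image)
qed

section \<open>Primitive scales\<close>

lemma zeta_power: "zeta N ^ k = exp (2 * of_real pi * \<i> * of_nat k / of_nat N)"
  unfolding zeta_def exp_of_nat_mult[symmetric] by (rule arg_cong[of _ _ exp]) simp

lemma primitive_zeta:
  assumes "N > 0" shows "primitive_root_of_unity N (zeta N)"
  unfolding primitive_root_of_unity_def zeta_power
  using assms complex_root_unity_eq_1[of N] by (auto dest: dvd_imp_le)

lemma cnj_zeta: "cnj (zeta N) = inverse (zeta N)"
  unfolding zeta_def exp_cnj exp_minus[symmetric] by simp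

lemma zeta_nonzero [simp]: "zeta N \<noteq> 0"
  by (simp add: zeta_def)

lemma cot_zeta:
  assumes "N > 0" "\<not> N dvd k"
  shows "cot (complex_of_real (pi * real k / real N)) = \<i> * ((zeta N ^ k + 1) / (zeta N ^ k - 1))"
proof -
  define x where "x = complex_of_real (pi * real k / real N)"
  define e where "e = exp (\<i> * x)"
  have e0: "e \<noteq> 0" by (simp add: e_def)
  have e2: "e ^ 2 = zeta N ^ k"
    unfolding e_def zeta_power exp_double[symmetric] by (rule arg_cong[of _ _ exp]) (simp add: x_def)
  have "zeta N ^ k \<noteq> 1" using primitive_root_of_unity_dvd[OF primitive_zeta] assms by simp
  hence "e ^ 2 \<noteq> 1" by (simp add: e2)
  have "cos x = (e + inverse e) / 2" by (simp add: cos_exp_eq e_def exp_minus)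
  also have "\<dots> = (e * (e + inverse e)) / (2 * e)" using e0 by simp
  also have "e * (e + inverse e) = e ^ 2 + 1" using e0 by (simp add: power2_eq_square distrib_left)
  finally have c: "cos x = (e ^ 2 + 1) / (2 * e)" .
  have "sin x = (e - inverse e) / (2 * \<i>)" by (simp add: sin_exp_eq e_def exp_minus)
  also have "\<dots> = (e * (e - inverse e)) / (2 * \<i> * e)" using e0 by simp
  also have "e * (e - inverse e) = e ^ 2 - 1" using e0 by (simp add: power2_eq_square right_diff_distrib)
  finally have s: "sin x = (e ^ 2 - 1) / (2 * \<i> * e)" .
  have "cot x = \<i> * ((e ^ 2 + 1) / (e ^ 2 - 1))"
    unfolding cot_def c s using e0 \<open>e ^ 2 \<noteq> 1\<close> by (simp add: divide_simps)
  thus ?thesis by (simp only: x_def e2)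
qed

lemma arith_geometric_sum:
  fixes u :: complex
  assumes "u ^ n = 1" "u \<noteq> 1"
  shows "(\<Sum>m<n. of_nat m * u ^ m) = of_nat n / (u - 1)"
proof -
  have *: "(u - 1) * (\<Sum>m<k. of_nat m * u ^ m) = of_nat k * u ^ k - (\<Sum>m<k. u ^ Suc m)" for k
    by (induction k) (simp_all add: algebra_simps)
  have "(\<Sum>m<n. u ^ Suc m) = u * (\<Sum>m<n. u ^ m)" by (simp add: sum_distrib_left)
  also have "(\<Sum>m<n. u ^ m) = 0" using assms by (simp add: sum_gp_strict)
  finally show ?thesis using *[of n] assms by (simp add: eq_divide_eq mult.commute)
qed

text \<open>From (v + 1)/(v - 1) = 1 + 2/(v - 1) and 1/(v - 1) = (1/n) \<Sum> m v^m for v^n = 1, v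
  \<noteq> 1, taken at v = u^k. The polynomial does not depend on u, so the same one serves for all
  conjugates.\<close>

definition cot_poly :: "nat \<Rightarrow> nat \<Rightarrow> rat poly" where
  "cot_poly n k = 1 + smult (2 / of_nat n) (\<Sum>m<n. monom (of_nat m) (k * m))"

lemma rat_poly_sum: "rat_poly (sum f I) = (\<Sum>i\<in>I. rat_poly (f i))"
  by (induction I rule: infinite_finite_induct) auto

lemma poly_cot_poly:
  assumes "u ^ n = 1" "u ^ k \<noteq> 1" "n > 0"
  shows "poly (rat_poly (cot_poly n k)) u = (u ^ k + 1) / (u ^ k - 1)"
proof -
  have "(u ^ k) ^ n = 1" by (metis assms(1) mult.commute power_mult power_one)
  from arith_geometric_sum[OF this assms(2)]
  have "(\<Sum>m<n. of_nat m * u ^ (k * m)) = of_nat n / (u ^ k - 1)" by (simp only: power_mult)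
  moreover have "poly (rat_poly (cot_poly n k)) u = 1 + 2 / of_nat n * (\<Sum>m<n. of_nat m * u ^ (k * m))"
    by (simp add: cot_poly_def rat_poly_sum poly_sum poly_monom of_rat_divide)
  ultimately have "poly (rat_poly (cot_poly n k)) u = 1 + 2 / (u ^ k - 1)" using assms(3) by simp
  also have "\<dots> = (u ^ k + 1) / (u ^ k - 1)" using assms(2) by (simp add: divide_simps)
  finally show ?thesis .
qed

definition half_units :: "nat \<Rightarrow> nat set" where
  "half_units N = {k. 1 \<le> k \<and> 2 * k < N \<and> coprime k N}"

lemma finite_half_units [simp]: "finite (half_units N)"
  by (rule finite_subset[of _ "{..N}"]) (auto simp: half_units_def)

lemma half_unitsD:
  assumes "k \<in> half_units N"
  shows "k > 0" "2 * k < N" "coprime k N" "\<not> N dvd k" "k < N"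
  using assms by (auto simp: half_units_def dest: dvd_imp_le)

lemma not_dvd_coprime_mult:
  fixes N j k :: nat
  assumes "coprime j N" "\<not> N dvd k" shows "\<not> N dvd j * k"
  using assms by (simp add: coprime_dvd_mult_right_iff coprime_commute)

text \<open>After removal of the common factor i the relation says that a rational polynomial
  vanishes at \<open>zeta N\<close>. It then vanishes at \<open>zeta N ^ j\<close>, and multiplying
  by i again gives the conjugate relation.\<close>

lemma cot_relation_conjugate:
  fixes a :: "nat \<Rightarrow> rat"
  assumes N: "N > 0" and j: "coprime j N"
    and rel: "(\<Sum>k\<in>half_units N. of_rat (a k) * cot (complex_of_real (pi * real k / real N))) = 0"
  shows "(\<Sum>k\<in>half_units N. of_rat (a k) * cot (complex_of_real (pi * real (j * k) / real N))) = 0"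
proof -
  define P where "P = (\<Sum>k\<in>half_units N. smult (a k) (cot_poly N k))"
  have P: "poly (rat_poly P) u = (\<Sum>k\<in>half_units N. of_rat (a k) * poly (rat_poly (cot_poly N k)) u)" for u
    by (simp add: P_def rat_poly_sum poly_sum)
  have z: "zeta N ^ N = 1" using primitive_zeta[OF N] by (simp add: primitive_root_of_unity_def)
  have ev: "poly (rat_poly P) (zeta N ^ i) * \<i> =
      (\<Sum>k\<in>half_units N. of_rat (a k) * cot (complex_of_real (pi * real (i * k) / real N)))"
    if "coprime i N" for i
    unfolding P sum_distrib_right
  proof (rule sum.cong[OF refl])
    fix k assume k: "k \<in> half_units N"
    have nd: "\<not> N dvd i * k" by (rule not_dvd_coprime_mult[OF that half_unitsD(4)[OF k]])
    have u: "(zeta N ^ i) ^ N = 1" by (metis z mult.commute power_mult power_one)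
    have "(zeta N ^ i) ^ k \<noteq> 1"
      using nd by (simp add: primitive_root_of_unity_dvd[OF primitive_zeta[OF N]] flip: power_mult)
    from poly_cot_poly[OF u this N] cot_zeta[OF N nd]
    show "of_rat (a k) * poly (rat_poly (cot_poly N k)) (zeta N ^ i) * \<i> =
      of_rat (a k) * cot (complex_of_real (pi * real (i * k) / real N))"
      by (simp only: power_mult mult_ac)
  qed
  have "poly (rat_poly P) (zeta N) = 0" using ev[of 1] rel by simp
  hence "poly (rat_poly P) (zeta N ^ j) = 0"
    by (rule galois_conjugate_root_of_unity[OF primitive_zeta[OF N] j])
  thus ?thesis using ev[OF j] by simp
qed

definition odd_extension :: "nat \<Rightarrow> (nat \<Rightarrow> rat) \<Rightarrow> nat \<Rightarrow> complex" where
  "odd_extension N a n = (if n mod N \<in> half_units N then of_rat (a (n mod N))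
     else if N - n mod N \<in> half_units N then - of_rat (a (N - n mod N)) else 0)"

lemma cot_reflect:
  assumes "N > 0" "k \<le> N"
  shows "cot (complex_of_real (pi * real (j * (N - k)) / real N)) =
     - cot (complex_of_real (pi * real (j * k) / real N))"
proof -
  have *: "cot (- x + pi * real m) = - cot x" for x :: real and m
    by (induction m) (simp_all add: distrib_left cot_def sin_add cos_add flip: add.assoc)
  have "pi * real (j * (N - k)) / real N = - (pi * real (j * k) / real N) + pi * real j"
    using assms by (simp add: of_nat_diff field_simps)
  thus ?thesis by (simp only: cot_of_real[symmetric] * of_real_minus)
qed

lemma coprime_diff_self:
  fixes i N :: nat
  assumes "coprime (N - i) N" shows "coprime i N"
proof (rule coprimeI)
  fix c assume "c dvd i" "c dvd N"
  with assms show "is_unit c" by (meson coprime_common_divisor dvd_diff_nat)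
qed

text \<open>Both the extension and the cotangent change sign under k to N - k, so the two halves of
  the unit residues contribute equally and the full sum is twice the conjugated relation.\<close>

lemma cot_kernel_odd_extension:
  assumes N: "N > 2"
    and rel: "(\<Sum>k\<in>half_units N. of_rat (a k) * cot (complex_of_real (pi * real k / real N))) = 0"
  shows "cot_kernel N (odd_extension N a)"
  unfolding cot_kernel_def
proof (intro conjI allI impI)
  fix n show "odd_extension N a (n mod N) = odd_extension N a n" by (simp add: odd_extension_def)
next
  fix n assume n: "\<not> coprime n N"
  have "\<not> coprime (n mod N) N" using n N by simp
  moreover have "\<not> coprime (N - n mod N) N"
    using coprime_diff_self[of N "n mod N"] calculation by blast
  ultimately show "odd_extension N a n = 0" by (auto simp: odd_extension_def half_units_def)
next
  fix m n assume mn: "N dvd m + n"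
  define r s where "r = m mod N" and "s = n mod N"
  have "N dvd r + s" using mn by (simp add: r_def s_def dvd_eq_mod_eq_0 mod_add_eq)
  moreover have "r < N" "s < N" using N by (simp_all add: r_def s_def)
  ultimately have "(r = 0 \<and> s = 0) \<or> s = N - r \<and> r > 0"
  proof -
    obtain t where t: "r + s = N * t" using \<open>N dvd r + s\<close> by (elim dvdE)
    have "N * t < N * 2" using \<open>r < N\<close> \<open>s < N\<close> t by linarith
    hence "t = 0 \<or> t = 1" by auto
    thus ?thesis using t \<open>r < N\<close> \<open>s < N\<close> by auto
  qed
  moreover have "0 \<notin> half_units N" "N \<notin> half_units N" by (auto simp: half_units_def)
  moreover have "\<not> (i \<in> half_units N \<and> N - i \<in> half_units N)" for i by (auto simp: half_units_def)
  ultimately show "odd_extension N a m = - odd_extension N a n"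
    using \<open>r < N\<close> unfolding odd_extension_def r_def[symmetric] s_def[symmetric] by auto
next
  fix j assume j: "coprime j N"
  let ?c = "\<lambda>k. cot (complex_of_real (pi * real (j * k) / real N))"
  let ?f = "odd_extension N a"
  define A where "A = half_units N"
  define A' where "A' = (\<lambda>k. N - k) ` half_units N"
  have A: "A \<subseteq> {..<N}" "A' \<subseteq> {..<N}" "A \<inter> A' = {}"
  proof -
    show "A \<subseteq> {..<N}" using half_unitsD(5) by (auto simp: A_def)
    show "A' \<subseteq> {..<N}" unfolding A'_def using half_unitsD(1) N by (auto intro!: diff_less)
    show "A \<inter> A' = {}"
    proof (rule ccontr)
      assume "A \<inter> A' \<noteq> {}"
      then obtain k where "N - k \<in> half_units N" "k \<in> half_units N" by (auto simp: A_def A'_def)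
      from half_unitsD(2)[OF this(1)] half_unitsD(2)[OF this(2)] show False by simp
    qed
  qed
  have fin: "finite A" "finite A'" by (auto simp: A_def A'_def)
  have zero: "?f k = 0" if "k \<in> {..<N} - (A \<union> A')" for k
  proof -
    have "N - k \<notin> half_units N"
    proof
      assume "N - k \<in> half_units N"
      hence "N - (N - k) \<in> A'" unfolding A'_def by blast
      thus False using that by simp
    qed
    thus ?thesis using that by (auto simp: odd_extension_def A_def)
  qed
  have "(\<Sum>k<N. ?f k * ?c k) = (\<Sum>k\<in>A \<union> A'. ?f k * ?c k)"
    using A zero by (intro sum.mono_neutral_right) auto
  also have "\<dots> = (\<Sum>k\<in>A. ?f k * ?c k) + (\<Sum>k\<in>A'. ?f k * ?c k)"
    using A fin by (intro sum.union_disjoint)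
  also have "(\<Sum>k\<in>A. ?f k * ?c k) = (\<Sum>k\<in>half_units N. of_rat (a k) * ?c k)"
    unfolding A_def by (intro sum.cong refl) (auto simp: odd_extension_def half_unitsD(5))
  also have "(\<Sum>k\<in>A'. ?f k * ?c k) = (\<Sum>k\<in>half_units N. ?f (N - k) * ?c (N - k))"
    unfolding A'_def by (subst sum.reindex) (auto simp: inj_on_def dest!: half_unitsD(5))
  also have "\<dots> = (\<Sum>k\<in>half_units N. of_rat (a k) * ?c k)"
  proof (rule sum.cong[OF refl])
    fix k assume k: "k \<in> half_units N"
    note kD = half_unitsD[OF k]
    have "(N - k) mod N = N - k" using kD by simp
    moreover have "N - k \<notin> half_units N" using kD by (auto simp: half_units_def)
    ultimately have "?f (N - k) = - of_rat (a k)" using k kD by (simp add: odd_extension_def)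
    moreover have "?c (N - k) = - ?c k" using kD by (intro cot_reflect) auto
    ultimately show "?f (N - k) * ?c (N - k) = of_rat (a k) * ?c k" by simp
  qed
  finally show "(\<Sum>k<N. ?f k * ?c k) = 0"
    using cot_relation_conjugate[OF _ j rel] N by simp
qed

theorem cot_independent:
  assumes "N > 2"
    and "(\<Sum>k\<in>half_units N. of_rat (a k) * cot (complex_of_real (pi * real k / real N))) = 0"
    and k: "k \<in> half_units N"
  shows "a k = 0"
proof -
  have "odd_extension N a k = 0"
    by (rule cot_kernel_trivial[OF cot_kernel_odd_extension[OF assms(1,2)]]) (use assms(1) in simp)
  thus ?thesis using k half_unitsD(5)[OF k] by (simp add: odd_extension_def)
qed

section \<open>The real cyclotomic field as a generated subfield\<close>

lemma type_ring_simps [simp]: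
  "carrier (ring_of_type_algebra :: complex ring) = UNIV"
  "x \<oplus>\<^bsub>ring_of_type_algebra\<^esub> y = x + (y :: complex)"
  "x \<otimes>\<^bsub>ring_of_type_algebra\<^esub> y = x * (y :: complex)"
  "\<one>\<^bsub>ring_of_type_algebra\<^esub> = (1 :: complex)"
  "\<zero>\<^bsub>ring_of_type_algebra\<^esub> = (0 :: complex)"
  by (simp_all add: ring_of_type_algebra_def)

lemma type_ring_a_inv [simp]: "\<ominus>\<^bsub>ring_of_type_algebra\<^esub> x = - (x :: complex)"
proof -
  interpret field "ring_of_type_algebra :: complex ring" by (rule field_from_type_algebra)
  show ?thesis by (rule minus_equality) simp_all
qed

lemma type_ring_m_inv:
  assumes "x \<noteq> (0 :: complex)" shows "inv\<^bsub>ring_of_type_algebra\<^esub> x = inverse x"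
proof -
  interpret field "ring_of_type_algebra :: complex ring" by (rule field_from_type_algebra)
  show ?thesis using assms by (intro comm_inv_char) simp_all
qed

lemma real_cyclotomic_field_closed:
  fixes N :: nat and x y :: complex
  shows "1 \<in> real_cyclotomic_field N"
    and "zeta N + inverse (zeta N) \<in> real_cyclotomic_field N"
    and "x \<in> real_cyclotomic_field N \<Longrightarrow> - x \<in> real_cyclotomic_field N"
    and "x \<in> real_cyclotomic_field N \<Longrightarrow> y \<in> real_cyclotomic_field N \<Longrightarrow> x + y \<in> real_cyclotomic_field N"
    and "x \<in> real_cyclotomic_field N \<Longrightarrow> y \<in> real_cyclotomic_field N \<Longrightarrow> x * y \<in> real_cyclotomic_field N"
    and "x \<in> real_cyclotomic_field N \<Longrightarrow> x \<noteq> 0 \<Longrightarrow> inverse x \<in> real_cyclotomic_field N"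
  unfolding real_cyclotomic_field_def
  using generate_field.one[of "ring_of_type_algebra :: complex ring"]
    generate_field.incl[of _ _ "ring_of_type_algebra :: complex ring"]
    generate_field.a_inv[of _ "ring_of_type_algebra :: complex ring"]
    generate_field.eng_add[of _ "ring_of_type_algebra :: complex ring"]
    generate_field.eng_mult[of _ "ring_of_type_algebra :: complex ring"]
    generate_field.m_inv[of _ "ring_of_type_algebra :: complex ring"]
  by (simp_all add: type_ring_m_inv)

lemma real_cyclotomic_field_subset:
  assumes "1 \<in> K" "zeta N + inverse (zeta N) \<in> K"
    and "\<And>x. x \<in> K \<Longrightarrow> - x \<in> K" "\<And>x y. x \<in> K \<Longrightarrow> y \<in> K \<Longrightarrow> x + y \<in> K"
    and "\<And>x y. x \<in> K \<Longrightarrow> y \<in> K \<Longrightarrow> x * y \<in> K" "\<And>x. x \<in> K \<Longrightarrow> x \<noteq> 0 \<Longrightarrow> inverse x \<in> K"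
  shows "real_cyclotomic_field N \<subseteq> K"
proof
  fix x assume "x \<in> real_cyclotomic_field N"
  thus "x \<in> K" unfolding real_cyclotomic_field_def
    by (induction rule: generate_field.induct) (use assms in \<open>auto simp: type_ring_m_inv\<close>)
qed

lemma of_int_real_cyclotomic_field: "of_int n \<in> real_cyclotomic_field N"
proof -
  note closed = real_cyclotomic_field_closed[where N = N]
  have "0 \<in> real_cyclotomic_field N" using closed(4)[OF closed(1) closed(3)[OF closed(1)]] by simp
  hence nat: "of_nat m \<in> real_cyclotomic_field N" for m
    by (induction m) (use closed(1,4) in auto)
  show ?thesis using nat closed(3) by (cases n rule: int_cases2) simp_all
qed

lemma of_rat_real_cyclotomic_field: "of_rat q \<in> real_cyclotomic_field N"
proof -
  obtain a b where q: "q = Rat.Fract a b" "b > 0" by (cases q)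
  have "of_int a * inverse (of_int b) \<in> real_cyclotomic_field N"
    using q by (intro real_cyclotomic_field_closed of_int_real_cyclotomic_field) auto
  thus ?thesis using q by (simp add: of_rat_rat divide_inverse)
qed

text \<open>With c_i = z^i + z^-i, the Chebyshev recursion c_(i+2) = c_1 c_(i+1) - c_i stays inside
  the field. The induction therefore carries two consecutive values.\<close>

lemma zeta_power_plus_inverse: "zeta N ^ i + inverse (zeta N) ^ i \<in> real_cyclotomic_field N"
proof -
  note closed = real_cyclotomic_field_closed[where N = N]
  define z where "z = zeta N"
  define c where "c = (\<lambda>i. z ^ i + inverse z ^ i)"
  have z: "z \<noteq> 0" by (simp add: z_def)
  have rec: "c (Suc (Suc i)) = c 1 * c (Suc i) + - c i" for i
  proof -
    have "c 1 * c (Suc i) = z * z ^ Suc i + inverse z * inverse z ^ Suc i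
        + (z * inverse z) * (inverse z ^ i + z ^ i)" by (simp add: c_def algebra_simps)
    thus ?thesis using z by (simp add: c_def)
  qed
  have c1: "c 1 \<in> real_cyclotomic_field N" using closed(2) by (simp add: c_def z_def)
  have "c i \<in> real_cyclotomic_field N \<and> c (Suc i) \<in> real_cyclotomic_field N"
  proof (induction i)
    case 0
    have "c 0 \<in> real_cyclotomic_field N" using closed(4)[OF closed(1) closed(1)] by (simp add: c_def)
    with c1 show ?case by simp
  next
    case (Suc i)
    thus ?case unfolding rec using closed(3-5) c1 by blast
  qed
  thus ?thesis by (simp add: c_def z_def)
qed

text \<open>A real x equals half of x + cnj x, and conjugation turns each power of
  \<open>zeta N\<close> into its inverse, so x is a rational combination of the sums already placed
  in the field.\<close>

lemma real_int_adjoin_zeta: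
  assumes x: "x \<in> int_adjoin (zeta N)" "cnj x = x"
  shows "x \<in> real_cyclotomic_field N"
proof -
  note closed = real_cyclotomic_field_closed[where N = N]
  obtain p where p: "x = poly (of_int_poly p) (zeta N)" using x by (auto simp: int_adjoin_def)
  have px: "x = (\<Sum>i\<le>degree p. of_int (coeff p i) * zeta N ^ i)" by (simp add: p poly_altdef)
  have "cnj x = (\<Sum>i\<le>degree p. of_int (coeff p i) * inverse (zeta N) ^ i)"
    unfolding px by (simp add: cnj_zeta)
  hence "x + x = (\<Sum>i\<le>degree p. of_int (coeff p i) * (zeta N ^ i + inverse (zeta N) ^ i))"
    using px x by (simp add: sum.distrib distrib_left)
  also have "\<dots> \<in> real_cyclotomic_field N"
  proof -
    have "finite I \<Longrightarrow> (\<Sum>i\<in>I. of_int (coeff p i) * (zeta N ^ i + inverse (zeta N) ^ i))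
        \<in> real_cyclotomic_field N" for I
    proof (induction I rule: finite_induct)
      case empty
      thus ?case using of_int_real_cyclotomic_field[of 0] by simp
    next
      case (insert i I)
      show ?case unfolding sum.insert[OF insert.hyps]
        by (intro closed of_int_real_cyclotomic_field zeta_power_plus_inverse insert.IH)
    qed
    thus ?thesis by simp
  qed
  finally have "of_rat (1 / 2) * (x + x) \<in> real_cyclotomic_field N"
    by (rule closed(5)[OF of_rat_real_cyclotomic_field])
  thus ?thesis by (simp add: of_rat_divide)
qed

section \<open>Scales as units of the ring of integers\<close>

text \<open>Since j is invertible modulo n, w^k is a power of w^j, which makes the quotient a
  geometric sum. Exchanging j and k covers the inverse as well.\<close>

lemma power_minus_1_quotient_int_adjoin:
  assumes w: "primitive_root_of_unity n w" and jk: "coprime j n" "coprime k n" and n: "n > 1"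
  shows "(w ^ k - 1) / (w ^ j - 1) \<in> int_adjoin w"
proof -
  have v: "primitive_root_of_unity n (w ^ j)" by (rule primitive_root_of_unity_power[OF w jk(1)])
  have "(w ^ k) ^ n = 1"
    using primitive_root_of_unity_power[OF w jk(2)] by (simp add: primitive_root_of_unity_def)
  then obtain m where m: "w ^ k = (w ^ j) ^ m" using roots_of_unity_eq_powers[OF v] by blast
  have "w ^ j \<noteq> 1" using v n by (auto simp: primitive_root_of_unity_def dest: spec[of _ 1])
  moreover have "(u ^ m - 1) / (u - 1) = (\<Sum>i<m. u ^ i)" if "u \<noteq> 1" for u :: complex
    using that by (simp add: power_diff_1_eq)
  ultimately have "(w ^ k - 1) / (w ^ j - 1) = (\<Sum>i<m. (w ^ j) ^ i)" unfolding m by blast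
  also have "\<dots> \<in> int_adjoin w" by (intro int_adjoin_sum int_adjoin_power int_adjoin_self)
  finally show ?thesis .
qed

lemma power_plus_1_quotient_int_adjoin:
  assumes w: "primitive_root_of_unity n w" and jk: "coprime j n" "coprime k n" and n: "n > 2"
  shows "(w ^ k + 1) / (w ^ j + 1) \<in> int_adjoin w"
proof -
  define v where "v = w ^ j"
  have v: "primitive_root_of_unity n v" unfolding v_def by (rule primitive_root_of_unity_power[OF w jk(1)])
  have u: "primitive_root_of_unity n (w ^ k)" by (rule primitive_root_of_unity_power[OF w jk(2)])
  then obtain m' where m': "w ^ k = v ^ m'"
    using roots_of_unity_eq_powers[OF v] by (auto simp: primitive_root_of_unity_def)
  have vn: "v ^ n = 1" using v by (simp add: primitive_root_of_unity_def)
  \<comment> \<open>The geometric sum in -v gives (v^m + 1)/(v + 1) only for odd m. If the exponent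
    found is even, n must be odd, as otherwise w^k would satisfy (w^k)^(n/2) = 1; adding n then
    makes the exponent odd.\<close>
  obtain m where m: "w ^ k = v ^ m" "odd m"
  proof (cases "odd m'")
    case True
    thus ?thesis using that m' by blast
  next
    case False
    have "odd n"
    proof
      assume "even n"
      then obtain l where l: "n = 2 * l" by auto
      obtain i where i: "m' = 2 * i" using False by auto
      have "(w ^ k) ^ l = (v ^ n) ^ i" unfolding m' by (simp add: i l mult_ac flip: power_mult)
      hence "(w ^ k) ^ l = 1" by (simp add: vn)
      thus False using u l n by (auto simp: primitive_root_of_unity_def)
    qed
    moreover have "w ^ k = v ^ (m' + n)" by (simp add: power_add vn m')
    ultimately show ?thesis using that[of "m' + n"] False by simp
  qed
  have v1: "v \<noteq> -1"
  proof
    assume "v = -1"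
    hence "v ^ 2 = 1" by simp
    thus False using v n by (auto simp: primitive_root_of_unity_def)
  qed
  have "(- v) ^ m - 1 = (- v - 1) * (\<Sum>i<m. (- v) ^ i)" by (rule power_diff_1_eq)
  hence "v ^ m + 1 = (v + 1) * (\<Sum>i<m. (- v) ^ i)"
    using m(2) by (simp add: algebra_simps)
  moreover have "v + 1 \<noteq> 0" using v1 by (simp add: eq_neg_iff_add_eq_0)
  ultimately have "(w ^ k + 1) / (v + 1) = (\<Sum>i<m. (- v) ^ i)" by (simp add: m)
  also have "\<dots> \<in> int_adjoin w"
    unfolding v_def by (intro int_adjoin_sum int_adjoin_power int_adjoin_minus int_adjoin_self)
  finally show ?thesis by (simp only: v_def)
qed

lemma tan_angle_pos:
  assumes "k \<in> half_units N"
  shows "tan (pi * real k / real N) > 0"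
proof (rule tan_gt_zero)
  have "2 * real k < real N" using half_unitsD(2)[OF assms] by linarith
  thus "pi * real k / real N < pi / 2" by (simp add: field_simps)
  show "0 < pi * real k / real N" using half_unitsD(1,5)[OF assms] by simp
qed

lemma one_half_units: "N \<ge> 3 \<Longrightarrow> 1 \<in> half_units N"
  by (simp add: half_units_def)

lemma complex_gon_scale:
  assumes "N \<ge> 3" "k \<in> half_units N"
  shows "complex_of_real (gon_scale N k) =
    of_real (tan (pi * real 1 / real N)) * cot (of_real (pi * real k / real N))"
proof -
  have "gon_scale N k = tan (pi * real 1 / real N) * cot (pi * real k / real N)"
    by (simp add: gon_scale_def gon_s_def cot_def tan_def mult.commute)
  thus ?thesis by (simp only: of_real_mult cot_of_real)
qed

text \<open>The factors i of the two cotangents cancel, leaving two quotients of the shapes just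
  treated. The exponent 1 is kept explicit so that those results match.\<close>

lemma gon_scale_zeta:
  assumes N: "N \<ge> 3" and k: "k \<in> half_units N"
  shows "complex_of_real (gon_scale N k) =
    ((zeta N ^ k + 1) / (zeta N ^ 1 + 1)) * ((zeta N ^ 1 - 1) / (zeta N ^ k - 1))"
proof -
  have N0: "N > 0" using N by simp
  have "complex_of_real (tan (pi * real 1 / real N)) * cot (of_real (pi * real 1 / real N)) = 1"
    using complex_gon_scale[OF N one_half_units[OF N]] tan_angle_pos[OF one_half_units[OF N]]
    by (simp add: gon_scale_def gon_s_def)
  hence "complex_of_real (tan (pi * real 1 / real N)) = inverse (cot (of_real (pi * real 1 / real N)))"
    by (metis inverse_unique mult.commute)
  hence "complex_of_real (gon_scale N k) =
      inverse (cot (of_real (pi * real 1 / real N))) * cot (of_real (pi * real k / real N))"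
    using complex_gon_scale[OF N k] by simp
  also have "\<dots> = ((zeta N ^ k + 1) / (zeta N ^ 1 + 1)) * ((zeta N ^ 1 - 1) / (zeta N ^ k - 1))"
    unfolding cot_zeta[OF N0 half_unitsD(4)[OF k]]
      cot_zeta[OF N0 half_unitsD(4)[OF one_half_units[OF N]]]
  proof -
    have "inverse (\<i> * (a / b)) * (\<i> * (c / d)) = (c / a) * (b / d)" for a b c d :: complex
      by (cases "a = 0"; cases "b = 0"; cases "d = 0") (auto simp: field_simps)
    thus "inverse (\<i> * ((zeta N ^ 1 + 1) / (zeta N ^ 1 - 1))) * (\<i> * ((zeta N ^ k + 1) / (zeta N ^ k - 1))) =
        ((zeta N ^ k + 1) / (zeta N ^ 1 + 1)) * ((zeta N ^ 1 - 1) / (zeta N ^ k - 1))" .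
  qed
  finally show ?thesis .
qed

lemma primitive_scales_eq: "primitive_scales N = (\<lambda>k. complex_of_real (gon_scale N k)) ` half_units N"
proof -
  have "1 \<le> k \<and> real k < real N / 2 \<and> gcd k N = 1 \<longleftrightarrow> k \<in> half_units N" for k
  proof -
    have "real k < real N / 2 \<longleftrightarrow> 2 * k < N" by linarith
    thus ?thesis by (simp only: half_units_def mem_Collect_eq coprime_iff_gcd_eq_1)
  qed
  thus ?thesis by (auto simp only: primitive_scales_def image_def)
qed

lemma gon_scale_pos:
  assumes "N \<ge> 3" "k \<in> half_units N" shows "gon_scale N k > 0"
  using tan_angle_pos[OF assms(2)] tan_angle_pos[OF one_half_units[OF assms(1)]]
  by (simp add: gon_scale_def gon_s_def mult.commute)

lemma gon_scale_int_adjoin: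
  assumes N: "N \<ge> 3" and k: "k \<in> half_units N"
  shows "complex_of_real (gon_scale N k) \<in> int_adjoin (zeta N)"
    and "inverse (complex_of_real (gon_scale N k)) \<in> int_adjoin (zeta N)"
proof -
  have w: "primitive_root_of_unity N (zeta N)" using N by (intro primitive_zeta) simp
  have cop: "coprime 1 N" "coprime k N" using half_unitsD(3)[OF k] by auto
  have N': "N > 1" "N > 2" using N by auto
  show "complex_of_real (gon_scale N k) \<in> int_adjoin (zeta N)"
    unfolding gon_scale_zeta[OF N k]
    by (intro int_adjoin_mult power_plus_1_quotient_int_adjoin[OF w cop N'(2)]
        power_minus_1_quotient_int_adjoin[OF w cop(2,1) N'(1)])
  show "inverse (complex_of_real (gon_scale N k)) \<in> int_adjoin (zeta N)"
    unfolding gon_scale_zeta[OF N k] inverse_mult_distrib inverse_divide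
    by (intro int_adjoin_mult power_plus_1_quotient_int_adjoin[OF w cop(2,1) N'(2)]
        power_minus_1_quotient_int_adjoin[OF w cop N'(1)])
qed

lemma primitive_scales_units:
  assumes N: "N \<ge> 3" and x: "x \<in> primitive_scales N"
  shows "x \<in> Units (ring_of_integers (real_cyclotomic_field N))"
proof -
  obtain k where k: "k \<in> half_units N" and xk: "x = complex_of_real (gon_scale N k)"
    using x by (auto simp: primitive_scales_eq)
  have x0: "x \<noteq> 0" using gon_scale_pos[OF N k] by (simp add: xk)
  have w: "zeta N ^ N = 1" "N > 0"
    using N primitive_zeta[of N] by (auto simp: primitive_root_of_unity_def)
  have int: "x \<in> int_adjoin (zeta N)" "inverse x \<in> int_adjoin (zeta N)"
    unfolding xk by (rule gon_scale_int_adjoin[OF N k])+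
  hence "algebraic_int x" "algebraic_int (inverse x)"
    using algebraic_int_int_adjoin_root_of_unity[OF w] by auto
  moreover have "x \<in> real_cyclotomic_field N" "inverse x \<in> real_cyclotomic_field N"
    using int by (auto intro!: real_int_adjoin_zeta simp: xk)
  ultimately show ?thesis using x0
    by (auto simp: Units_def ring_of_integers_def intro!: bexI[of _ "inverse x"])
qed

text \<open>The scales are collected in a set: coinciding values would merge coefficients of a
  relation and lower the count on which spanning rests. The tangent is strictly increasing on the
  angles involved.\<close>

lemma gon_scale_inj:
  assumes N: "N \<ge> 3" shows "inj_on (\<lambda>k. complex_of_real (gon_scale N k)) (half_units N)"
proof (rule linorder_inj_onI')
  fix k l assume kl: "k \<in> half_units N" "l \<in> half_units N" "k < l"
  have "2 * real l < real N" using half_unitsD(2)[OF kl(2)] by linarith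
  hence "pi * real l / real N < pi / 2" by (simp add: field_simps)
  moreover have "pi * real k / real N < pi * real l / real N"
    using kl N by (intro divide_strict_right_mono mult_strict_left_mono) auto
  moreover have "- (pi / 2) < pi * real k / real N"
  proof -
    have "0 \<le> pi * real k / real N" by simp
    thus ?thesis using pi_gt_zero by linarith
  qed
  ultimately have "tan (pi * real k / real N) < tan (pi * real l / real N)"
    by (intro tan_monotone)
  thus "complex_of_real (gon_scale N k) \<noteq> complex_of_real (gon_scale N l)"
    using tan_angle_pos[OF kl(1)] tan_angle_pos[OF kl(2)] tan_angle_pos[OF one_half_units[OF N]]
    by (auto simp: gon_scale_def gon_s_def mult.commute)
qed

section \<open>The primitive scales form a basis\<close>

lemma primitive_scales_independent:
  assumes N: "N \<ge> 3" shows "rat_vs.independent (primitive_scales N)"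
proof (rule rat_vs.independent_if_scalars_zero)
  show "finite (primitive_scales N)" by (simp add: primitive_scales_eq)
  fix u x assume sum: "(\<Sum>x\<in>primitive_scales N. rat_scale (u x) x) = 0" and x: "x \<in> primitive_scales N"
  define s where "s = (\<lambda>k. complex_of_real (gon_scale N k))"
  define t where "t = complex_of_real (tan (pi * real 1 / real N))"
  have t: "t \<noteq> 0" using tan_angle_pos[OF one_half_units[OF N]] by (simp add: t_def)
  have "(\<Sum>x\<in>primitive_scales N. rat_scale (u x) x) = (\<Sum>k\<in>half_units N. of_rat (u (s k)) * s k)"
    unfolding primitive_scales_eq s_def rat_scale_def by (subst sum.reindex[OF gon_scale_inj[OF N]]) simp
  also have "\<dots> = t * (\<Sum>k\<in>half_units N. of_rat (u (s k)) * cot (of_real (pi * real k / real N)))"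
    unfolding sum_distrib_left
    by (intro sum.cong refl) (simp only: s_def t_def complex_gon_scale[OF N] mult_ac)
  finally have "(\<Sum>k\<in>half_units N. of_rat (u (s k)) * cot (complex_of_real (pi * real k / real N))) = 0"
    using sum t by simp
  hence "u (s k) = 0" if "k \<in> half_units N" for k
    using N by (intro cot_independent[of N "\<lambda>k. u (s k)" k] that) auto
  thus "u x = 0" using x by (auto simp: primitive_scales_eq s_def)
qed

lemma card_coprime_le:
  assumes N: "N \<ge> 3" shows "card {k. k < N \<and> coprime k N} \<le> 2 * card (half_units N)"
proof -
  have "{k. k < N \<and> coprime k N} \<subseteq> half_units N \<union> (\<lambda>k. N - k) ` half_units N"
  proof
    fix k assume "k \<in> {k. k < N \<and> coprime k N}"
    hence k: "k < N" "coprime k N" by auto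
    have k0: "k > 0" using k N by (auto intro!: Nat.gr0I)
    \<comment> \<open>The midpoint N/2 divides \<open>N\<close>, so it is coprime to
      \<open>N\<close> only for N = 2; otherwise each unit residue pairs with a different
      one.\<close>
    have "2 * k \<noteq> N"
    proof
      assume "2 * k = N"
      hence "k dvd N" by auto
      hence "k = 1" using coprime_common_divisor[OF k(2), of k] by auto
      thus False using \<open>2 * k = N\<close> N by simp
    qed
    show "k \<in> half_units N \<union> (\<lambda>k. N - k) ` half_units N"
    proof (cases "2 * k < N")
      case True
      thus ?thesis using k k0 by (simp add: half_units_def)
    next
      case False
      have "coprime (N - (N - k)) N" using k by simp
      hence "coprime (N - k) N" by (rule coprime_diff_self)
      hence "N - k \<in> half_units N" using False \<open>2 * k \<noteq> N\<close> k by (auto simp: half_units_def)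
      moreover have "k = N - (N - k)" using k by simp
      ultimately show ?thesis by blast
    qed
  qed
  hence "card {k. k < N \<and> coprime k N} \<le> card (half_units N \<union> (\<lambda>k. N - k) ` half_units N)"
    by (intro card_mono) auto
  also have "\<dots> \<le> card (half_units N) + card ((\<lambda>k. N - k) ` half_units N)" by (rule card_Un_le)
  also have "\<dots> \<le> 2 * card (half_units N)" using card_image_le[of "half_units N" "\<lambda>k. N - k"] by simp
  finally show ?thesis .
qed

lemma primitive_scales_span:
  assumes N: "N \<ge> 3" shows "rat_vs.span (primitive_scales N) = real_cyclotomic_field N"
proof
  note closed = real_cyclotomic_field_closed[where N = N]
  have B: "primitive_scales N \<subseteq> real_cyclotomic_field N"
    unfolding primitive_scales_eq using gon_scale_int_adjoin(1)[OF N] by (auto intro!: real_int_adjoin_zeta)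
  have "rat_vs.subspace (real_cyclotomic_field N)"
    unfolding rat_vs.subspace_def rat_scale_def
    using closed of_rat_real_cyclotomic_field of_int_real_cyclotomic_field[of 0 N] by auto
  with B show "rat_vs.span (primitive_scales N) \<subseteq> real_cyclotomic_field N"
    by (rule rat_vs.span_minimal)
  have w: "primitive_root_of_unity N (zeta N)" using N by (intro primitive_zeta) simp
  have "zeta N ^ N = 1" using w by (simp add: primitive_root_of_unity_def)
  moreover have "unity_poly N \<noteq> 0"
    using N by (auto simp: unity_poly_def poly_eq_iff dest: spec[of _ 0])
  ultimately obtain f where f: "is_min_poly f (zeta N)"
    using min_poly_exists[of "unity_poly N" "zeta N"] by (auto simp: poly_unity_poly)
  define T where "T = (\<lambda>i. zeta N ^ i) ` {..<degree f}"
  have T: "finite T" "card T \<le> 2 * card (primitive_scales N)"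
  proof -
    have "card T \<le> degree f" unfolding T_def using card_image_le[of "{..<degree f}"] by simp
    also have "\<dots> \<le> card {k. k < N \<and> coprime k N}" by (rule min_poly_root_of_unity_degree[OF w f])
    also have "\<dots> \<le> 2 * card (half_units N)" by (rule card_coprime_le[OF N])
    finally show "card T \<le> 2 * card (primitive_scales N)"
      unfolding primitive_scales_eq by (simp add: card_image gon_scale_inj[OF N])
  qed (simp add: T_def)
  have spanT: "x \<in> rat_vs.span T" if "x \<in> rat_adjoin (zeta N)" for x
    using that rat_adjoin_span[OF f] by (auto simp: T_def)
  have inv: "inverse (zeta N) \<in> rat_adjoin (zeta N)" by (rule rat_adjoin_inverse[OF f]) simp
  have F: "real_cyclotomic_field N \<subseteq> rat_adjoin (zeta N) \<inter> \<real>"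
  proof (rule real_cyclotomic_field_subset)
    have "cnj (zeta N + inverse (zeta N)) = zeta N + inverse (zeta N)"
      by (simp add: cnj_zeta)
    thus "zeta N + inverse (zeta N) \<in> rat_adjoin (zeta N) \<inter> \<real>"
      using inv by (auto intro!: rat_adjoin_add simp: Reals_cnj_iff)
  qed (auto intro: rat_adjoin_add rat_adjoin_mult rat_adjoin_minus rat_adjoin_inverse[OF f])
  define t where "t = zeta N - inverse (zeta N)"
  have t: "cnj t = - t" "t \<in> rat_adjoin (zeta N)"
    using rat_adjoin_add[OF _ rat_adjoin_minus[OF inv]] by (simp_all add: t_def cnj_zeta)
  have "t \<noteq> 0"
  proof
    assume "t = 0"
    hence "zeta N = inverse (zeta N)" by (simp add: t_def)
    hence "zeta N * zeta N = inverse (zeta N) * zeta N" by (rule arg_cong)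
    hence "zeta N ^ 2 = 1" by (simp add: power2_eq_square)
    hence "N dvd 2" by (simp add: primitive_root_of_unity_dvd[OF w])
    thus False using N by (auto dest: dvd_imp_le)
  qed
  show "real_cyclotomic_field N \<subseteq> rat_vs.span (primitive_scales N)"
  proof (rule ccontr)
    assume "\<not> real_cyclotomic_field N \<subseteq> rat_vs.span (primitive_scales N)"
    then obtain y where y: "y \<in> real_cyclotomic_field N" "y \<notin> rat_vs.span (primitive_scales N)" by blast
    \<comment> \<open>One further real element independent of the scales, together with the
      multiples by t, would give two more independent elements of the span of \<open>T\<close> than
      \<open>card T\<close> permits.\<close>
    define C where "C = insert y (primitive_scales N)"
    have C: "C \<subseteq> rat_adjoin (zeta N) \<inter> \<real>" using y B F by (auto simp: C_def)
    have "rat_vs.independent C"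
      unfolding C_def by (rule rat_vs.independent_insertI[OF y(2) primitive_scales_independent[OF N]])
    moreover have "t * b \<in> rat_vs.span T" if "b \<in> C" for b
      using that C t by (intro spanT rat_adjoin_mult) auto
    ultimately have "2 * card C \<le> card T"
      using C spanT card_independent_reals[OF T(1), of C t] \<open>t \<noteq> 0\<close> t(1) by blast
    moreover have "card C = Suc (card (primitive_scales N))"
      unfolding C_def using y rat_vs.span_base by (subst card_insert_disjoint) (auto simp: primitive_scales_eq)
    ultimately show False using T(2) by simp
  qed
qed

theorem lemma3p3:
  fixes N :: nat
  assumes "N \<ge> 3"
  shows "is_rat_basis (primitive_scales N) (real_cyclotomic_field N) \<and>
         (\<forall>x \<in> primitive_scales N. x \<in> Units (ring_of_integers (real_cyclotomic_field N)))"
  using primitive_scales_independent[OF assms] primitive_scales_span[OF assms]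
    primitive_scales_units[OF assms] by (simp add: is_rat_basis_def)

end
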